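(* Let $A = \sigma(R)\langle x_1, \dots, x_n\rangle$ be a skew PBW extension over a $(\Sigma,\Delta)$-compatible and NI ring $R$. If for each principal right ideal $pR\nsubseteq N(R)$ (with $p\in R$), $N_R(pR)$ is generated as an ideal by a nilpotent element, then for each principal right ideal $fA\nsubseteq N(A)$ (with $f\in A$), $N_A(fA)$ is generated as an ideal by a nilpotent element.
   Context: All rings are associative with identity, not necessarily commutative. $\mathbb{N}$ includes $0$. For a ring $R$, $N(R)$ is the set of nilpotent elements of $R$ and $N^*(R)$ is the sum of all nil ideals of $R$; $R$ is NI if $N^*(R)=N(R)$. Skew PBW extension: $A=\sigma(R)\langle x_1,\dots,x_n\rangle$ is a skew PBW extension over $R$ if (i) $R$ is a subring of $A$ with the same identity; (ii) there are $x_1,\dots,x_n\in A$ such that $A$ is a free left $R$-module with basis $\mathrm{Mon}(A)=\{x^\alpha = x_1^{\alpha_1}\cdots x_n^{\alpha_n} \mid \alpha\in\mathbb{N}^n\}$; (iii) for each $1\le i\le n$ and $r\in R\setminus\{0\}$ there is $c_{i,r}\in R\setminus\{0\}$ with $x_i r - c_{i,r}x_i\in R$; (iv) for all $1\le i,j\le n$ there is $d_{i,j}\in R\setminus\{0\}$ with $x_jx_i - d_{i,j}x_ix_j\in R+Rx_1+\cdots+Rx_n$. For such $A$ there exist, for each $i$, an injective endomorphism $\sigma_i$ of $R$ and a $\sigma_i$-derivation $\delta_i$ of $R$ (additive, $\delta_i(rs)=\sigma_i(r)\delta_i(s)+\delta_i(r)s$) with $x_ir=\sigma_i(r)x_i+\delta_i(r)$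 for all $r\in R$. Put $\Sigma=\{\sigma_1,\dots,\sigma_n\}$, $\Delta=\{\delta_1,\dots,\delta_n\}$, and for $\alpha\in\mathbb{N}^n$, $\sigma^\alpha=\sigma_1^{\alpha_1}\circ\cdots\circ\sigma_n^{\alpha_n}$, $\delta^\alpha=\delta_1^{\alpha_1}\circ\cdots\circ\delta_n^{\alpha_n}$. $R$ is $\Sigma$-compatible if for all $a,b\in R$ and $\alpha\in\mathbb{N}^n$: $a\sigma^\alpha(b)=0$ if and only if $ab=0$. $R$ is $\Delta$-compatible if for all $a,b\in R$ and $\beta\in\mathbb{N}^n$: $ab=0$ implies $a\delta^\beta(b)=0$. $R$ is $(\Sigma,\Delta)$-compatible if it is both. Weak annihilator: for a ring $S$ and $X\subseteq S$, $N_S(X)=\{a\in S\mid xa\in N(S)\text{ for all }x\in X\}$; it is an ideal of $S$ whenever $N(S)$ is. "$N_S(X)$ is generated as an ideal by a nilpotent element" is used in the form: there is $c\in N(S)$ with $N_S(X)=cS$. *)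

theory Defs
  imports "HOL-Algebra.Algebra"
begin

definition nilpotents :: "('a, 'b) ring_scheme \<Rightarrow> 'a set" where
  "nilpotents S = {a \<in> carrier S. \<exists>k::nat. a [^]\<^bsub>S\<^esub> k = \<zero>\<^bsub>S\<^esub>}"

definition nil_ideal :: "'a set \<Rightarrow> ('a, 'b) ring_scheme \<Rightarrow> bool" where
  "nil_ideal I S \<longleftrightarrow> ideal I S \<and> I \<subseteq> nilpotents S"

text \<open>The sum of all nil ideals: the finite sums of elements \<open>a I \<in> I\<close>, with \<open>I\<close> ranging over a
  finite family of nil ideals.\<close>

definition upper_nilradical :: "('a, 'b) ring_scheme \<Rightarrow> 'a set" where
  "upper_nilradical S =
     {finsum S a F | a F. finite F \<and> (\<forall>I\<in>F. nil_ideal I S \<and> a I \<in> I)}"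

definition NI_ring :: "('a, 'b) ring_scheme \<Rightarrow> bool" where
  "NI_ring S \<longleftrightarrow> ring S \<and> upper_nilradical S = nilpotents S"

definition principal_right_ideal :: "('a, 'b) ring_scheme \<Rightarrow> 'a \<Rightarrow> 'a set" where
  "principal_right_ideal S p = {p \<otimes>\<^bsub>S\<^esub> s | s. s \<in> carrier S}"

definition weak_annihilator :: "('a, 'b) ring_scheme \<Rightarrow> 'a set \<Rightarrow> 'a set" where
  "weak_annihilator S T = {a \<in> carrier S. \<forall>x\<in>T. x \<otimes>\<^bsub>S\<^esub> a \<in> nilpotents S}"

text \<open>As the weak annihilators in question are two-sided ideals, being generated as an ideal by a
  nilpotent \<open>c\<close> is read as being equal to \<open>c S\<close>.\<close>

definition generated_by_nilpotent :: "('a, 'b) ring_scheme \<Rightarrow> 'a set \<Rightarrow> bool" where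
  "generated_by_nilpotent S I \<longleftrightarrow> (\<exists>c\<in>nilpotents S. I = principal_right_ideal S c)"

text \<open>The variables \<open>x\<^sub>1, \<dots>, x\<^sub>n\<close> are \<open>x 0, \<dots>, x (n - 1)\<close>. A multi-index is a function
  \<open>nat \<Rightarrow> nat\<close> vanishing from \<open>n\<close> on, and products and composites are taken in increasing order of
  the index, from left to right.\<close>

definition multi_indices :: "nat \<Rightarrow> (nat \<Rightarrow> nat) set" where
  "multi_indices n = {\<alpha>. \<forall>i\<ge>n. \<alpha> i = 0}"

definition monomial :: "('a, 'b) ring_scheme \<Rightarrow> nat \<Rightarrow> (nat \<Rightarrow> 'a) \<Rightarrow> (nat \<Rightarrow> nat) \<Rightarrow> 'a" where
  "monomial A n x \<alpha> = foldr (\<lambda>i y. (x i [^]\<^bsub>A\<^esub> \<alpha> i) \<otimes>\<^bsub>A\<^esub> y) [0..<n] \<one>\<^bsub>A\<^esub>"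

definition multi_funpow :: "nat \<Rightarrow> (nat \<Rightarrow> 'a \<Rightarrow> 'a) \<Rightarrow> (nat \<Rightarrow> nat) \<Rightarrow> 'a \<Rightarrow> 'a" where
  "multi_funpow n \<phi> \<alpha> = foldr (\<lambda>i g. (\<phi> i ^^ \<alpha> i) \<circ> g) [0..<n] id"

definition left_coeffs :: "('a, 'b) ring_scheme \<Rightarrow> nat \<Rightarrow> ((nat \<Rightarrow> nat) \<Rightarrow> 'a) set" where
  "left_coeffs R n = {c. (\<forall>\<alpha>. c \<alpha> \<in> carrier R) \<and>
     {\<alpha>. c \<alpha> \<noteq> \<zero>\<^bsub>R\<^esub>} \<subseteq> multi_indices n \<and> finite {\<alpha>. c \<alpha> \<noteq> \<zero>\<^bsub>R\<^esub>}}"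

definition left_combination ::
  "('a, 'b) ring_scheme \<Rightarrow> nat \<Rightarrow> (nat \<Rightarrow> 'a) \<Rightarrow> ((nat \<Rightarrow> nat) \<Rightarrow> 'a) \<Rightarrow> 'a" where
  "left_combination A n x c =
     (\<Oplus>\<^bsub>A\<^esub>\<alpha>\<in>{\<alpha>. c \<alpha> \<noteq> \<zero>\<^bsub>A\<^esub>}. c \<alpha> \<otimes>\<^bsub>A\<^esub> monomial A n x \<alpha>)"

definition free_left_on_monomials ::
  "('a, 'b) ring_scheme \<Rightarrow> ('a, 'b) ring_scheme \<Rightarrow> nat \<Rightarrow> (nat \<Rightarrow> 'a) \<Rightarrow> bool" where
  "free_left_on_monomials R A n x \<longleftrightarrow>
     (\<forall>f\<in>carrier A. \<exists>!c. c \<in> left_coeffs R n \<and> f = left_combination A n x c)"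

text \<open>The ring \<open>R\<close> has the operations of \<open>A\<close>; the locale \<open>subring\<close> makes the identity of \<open>A\<close>
  belong to its carrier.\<close>

definition is_subring_of :: "('a, 'b) ring_scheme \<Rightarrow> ('a, 'b) ring_scheme \<Rightarrow> bool" where
  "is_subring_of R A \<longleftrightarrow>
     ring A \<and> subring (carrier R) A \<and> R = A\<lparr>carrier := carrier R\<rparr>"

definition skew_pbw_extension ::
  "('a, 'b) ring_scheme \<Rightarrow> ('a, 'b) ring_scheme \<Rightarrow> nat \<Rightarrow> (nat \<Rightarrow> 'a) \<Rightarrow> bool" where
  "skew_pbw_extension R A n x \<longleftrightarrow>
     is_subring_of R A \<and>
     (\<forall>i<n. x i \<in> carrier A) \<and>
     free_left_on_monomials R A n x \<and>
     (\<forall>i<n. \<forall>r\<in>carrier R - {\<zero>\<^bsub>R\<^esub>}. \<exists>c\<in>carrier R - {\<zero>\<^bsub>R\<^esub>}.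
        x i \<otimes>\<^bsub>A\<^esub> r \<ominus>\<^bsub>A\<^esub> c \<otimes>\<^bsub>A\<^esub> x i \<in> carrier R) \<and>
     (\<forall>i<n. \<forall>j<n. \<exists>d\<in>carrier R - {\<zero>\<^bsub>R\<^esub>}. \<exists>r\<in>carrier R. \<exists>t\<in>{..<n} \<rightarrow> carrier R.
        x j \<otimes>\<^bsub>A\<^esub> x i \<ominus>\<^bsub>A\<^esub> d \<otimes>\<^bsub>A\<^esub> x i \<otimes>\<^bsub>A\<^esub> x j = r \<oplus>\<^bsub>A\<^esub> (\<Oplus>\<^bsub>A\<^esub>k\<in>{..<n}. t k \<otimes>\<^bsub>A\<^esub> x k))"

definition skew_derivation ::
  "('a, 'b) ring_scheme \<Rightarrow> ('a \<Rightarrow> 'a) \<Rightarrow> ('a \<Rightarrow> 'a) \<Rightarrow> bool" where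
  "skew_derivation R s d \<longleftrightarrow>
     d \<in> carrier R \<rightarrow> carrier R \<and>
     (\<forall>a\<in>carrier R. \<forall>b\<in>carrier R. d (a \<oplus>\<^bsub>R\<^esub> b) = d a \<oplus>\<^bsub>R\<^esub> d b) \<and>
     (\<forall>a\<in>carrier R. \<forall>b\<in>carrier R. d (a \<otimes>\<^bsub>R\<^esub> b) = s a \<otimes>\<^bsub>R\<^esub> d b \<oplus>\<^bsub>R\<^esub> d a \<otimes>\<^bsub>R\<^esub> b)"

text \<open>In a skew PBW extension such families exist, and by freeness they are uniquely determined on
  \<open>carrier R\<close>.\<close>

definition skew_pbw_maps ::
  "('a, 'b) ring_scheme \<Rightarrow> ('a, 'b) ring_scheme \<Rightarrow> nat \<Rightarrow> (nat \<Rightarrow> 'a) \<Rightarrow>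
    (nat \<Rightarrow> 'a \<Rightarrow> 'a) \<Rightarrow> (nat \<Rightarrow> 'a \<Rightarrow> 'a) \<Rightarrow> bool" where
  "skew_pbw_maps R A n x \<sigma> \<delta> \<longleftrightarrow>
     (\<forall>i<n. \<sigma> i \<in> ring_hom R R \<and> inj_on (\<sigma> i) (carrier R) \<and>
        skew_derivation R (\<sigma> i) (\<delta> i) \<and>
        (\<forall>r\<in>carrier R. x i \<otimes>\<^bsub>A\<^esub> r = \<sigma> i r \<otimes>\<^bsub>A\<^esub> x i \<oplus>\<^bsub>A\<^esub> \<delta> i r))"

definition Sigma_compatible ::
  "('a, 'b) ring_scheme \<Rightarrow> nat \<Rightarrow> (nat \<Rightarrow> 'a \<Rightarrow> 'a) \<Rightarrow> bool" where
  "Sigma_compatible R n \<sigma> \<longleftrightarrow>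
     (\<forall>a\<in>carrier R. \<forall>b\<in>carrier R. \<forall>\<alpha>\<in>multi_indices n.
        a \<otimes>\<^bsub>R\<^esub> multi_funpow n \<sigma> \<alpha> b = \<zero>\<^bsub>R\<^esub> \<longleftrightarrow> a \<otimes>\<^bsub>R\<^esub> b = \<zero>\<^bsub>R\<^esub>)"

definition Delta_compatible ::
  "('a, 'b) ring_scheme \<Rightarrow> nat \<Rightarrow> (nat \<Rightarrow> 'a \<Rightarrow> 'a) \<Rightarrow> bool" where
  "Delta_compatible R n \<delta> \<longleftrightarrow>
     (\<forall>a\<in>carrier R. \<forall>b\<in>carrier R. \<forall>\<beta>\<in>multi_indices n.
        a \<otimes>\<^bsub>R\<^esub> b = \<zero>\<^bsub>R\<^esub> \<longrightarrow> a \<otimes>\<^bsub>R\<^esub> multi_funpow n \<delta> \<beta> b = \<zero>\<^bsub>R\<^esub>)"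

end

theory Submission
  imports Defs
begin

text \<open>
Write \<open>N(R)\<close> for the set of nilpotent elements. If some \<open>f A\<close> is not contained in \<open>N(A)\<close>, then
\<open>1\<close> is not nilpotent, and the hypothesis at \<open>p = 1\<close> gives \<open>N(R) = c R\<close> with \<open>c\<close> nilpotent, because
the weak annihilator of \<open>R\<close> in an NI ring is \<open>N(R)\<close> itself. For an arbitrary \<open>p \<notin> N(R)\<close> the weak
annihilator of \<open>p R\<close> is again generated by a nilpotent element, so it lies in \<open>N(R)\<close>. As
\<open>a b \<in> N(R)\<close> puts \<open>b\<close> into the weak annihilator of \<open>a R\<close>, this says that \<open>N(R)\<close> is a completely
prime ideal: the hypothesis makes \<open>R / N(R)\<close> a domain
(\<open>nilpotents_principal_completely_prime\<close>).

By compatibility \<open>N(R)\<close> is mapped into itself by every \<open>\<delta> i\<close> and is its own preimage under every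
\<open>\<sigma> i\<close>. For any completely prime ideal \<open>P\<close> of \<open>R\<close> with these stability properties, the elements of
\<open>A\<close> with all coefficients in \<open>P\<close> form a two-sided ideal \<open>P A\<close>, and this ideal is completely prime
(\<open>extended_ideal_completely_prime\<close>). The reason is a leading term argument: modulo \<open>P A\<close> and lower
terms, \<open>(a x\<^sup>\<alpha>) (b x\<^sup>\<beta>)\<close> is \<open>a \<sigma>\<^sup>\<alpha>(b) d x\<^sup>\<alpha>\<^sup>+\<^sup>\<beta>\<close> with \<open>d \<notin> P\<close>.

For \<open>P = N(R) = c R\<close> this ideal is \<open>c A\<close>. It consists of nilpotent elements, since \<open>A c \<subseteq> c A\<close> gives
\<open>(c g)\<^sup>k \<in> c\<^sup>k A\<close>; it contains all nilpotent elements, since it is completely prime. Hence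
\<open>N(A) = c A\<close>. Finally, for \<open>f \<notin> N(A)\<close> complete primeness also shows that the weak annihilator of
\<open>f A\<close> is \<open>N(A) = c A\<close>.
\<close>

section \<open>Multi-indices and weights\<close>

definition inc :: "nat \<Rightarrow> (nat \<Rightarrow> nat) \<Rightarrow> nat \<Rightarrow> nat" where
  "inc i \<alpha> = \<alpha>(i := Suc (\<alpha> i))"

lemma inc_apply: "inc i \<alpha> k = (if k = i then Suc (\<alpha> i) else \<alpha> k)"
  by (simp add: inc_def)

lemma inc_commute: "inc i (inc j \<alpha>) = inc j (inc i \<alpha>)"
  by (rule ext) (simp add: inc_apply)

lemma inc_in_multi_indices [simp]:
  "\<alpha> \<in> multi_indices n \<Longrightarrow> i < n \<Longrightarrow> inc i \<alpha> \<in> multi_indices n"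
  by (auto simp: multi_indices_def inc_apply)

lemma zero_in_multi_indices [simp]: "(\<lambda>_. 0) \<in> multi_indices n"
  by (simp add: multi_indices_def)

text \<open>Taking \<open>j\<close> to be the first index in the support of \<open>\<alpha>\<close> is what makes \<open>x\<^sup>\<alpha> = x\<^sub>j x\<^sup>\<beta>\<close> hold without
any commutation.\<close>

lemma multi_index_decompose:
  assumes "\<alpha> \<in> multi_indices n" "\<alpha> \<noteq> (\<lambda>_. 0)"
  obtains j \<beta> where "j < n" "\<beta> \<in> multi_indices n" "\<alpha> = inc j \<beta>" "\<forall>i<j. \<beta> i = 0"
proof -
  from assms(2) have ex: "\<exists>i. \<alpha> i \<noteq> 0" by auto
  define j where "j = (LEAST i. \<alpha> i \<noteq> 0)"
  have j: "\<alpha> j \<noteq> 0" and below: "\<forall>i<j. \<alpha> i = 0"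
    unfolding j_def using LeastI_ex[OF ex] by (blast, blast dest: not_less_Least)
  have "j < n" by (rule ccontr) (use j assms(1) in \<open>simp add: multi_indices_def\<close>)
  then show ?thesis
    by (rule that[of j "\<alpha>(j := \<alpha> j - 1)"])
      (use assms(1) j below in \<open>auto simp: multi_indices_def inc_def\<close>)
qed

lemma multi_index_induct [consumes 1, case_names zero inc]:
  assumes "\<alpha> \<in> multi_indices n"
    and "Q (\<lambda>_. 0)"
    and "\<And>\<alpha> j. \<alpha> \<in> multi_indices n \<Longrightarrow> j < n \<Longrightarrow> \<forall>i<j. \<alpha> i = 0 \<Longrightarrow> Q \<alpha> \<Longrightarrow> Q (inc j \<alpha>)"
  shows "Q \<alpha>"
  using assms(1)
proof (induction "\<Sum>i<n. \<alpha> i" arbitrary: \<alpha> rule: less_induct)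
  case less
  show ?case
  proof (cases "\<alpha> = (\<lambda>_. 0)")
    case False
    then obtain j \<beta> where j: "j < n" and \<beta>: "\<beta> \<in> multi_indices n" "\<alpha> = inc j \<beta>" "\<forall>i<j. \<beta> i = 0"
      using multi_index_decompose[OF less.prems] by metis
    have "(\<Sum>i<n. \<beta> i) < (\<Sum>i<n. \<alpha> i)"
      using j by (intro sum_strict_mono_ex1) (auto simp: \<beta>(2) inc_apply intro!: bexI[of _ j])
    from less.hyps[OF this \<beta>(1)] show ?thesis using assms(3)[OF \<beta>(1) j \<beta>(3)] \<beta>(2) by simp
  qed (use assms(2) in simp)
qed

text \<open>The sums below read \<open>\<alpha> 0, \<dots>, \<alpha> (n - 1)\<close> as the digits of a number in base \<open>B\<close>, the most
significant digit first.\<close>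

lemma sum_digits_Suc:
  fixes B :: nat
  shows "(\<Sum>i<Suc n. \<alpha> i * B ^ (n - i)) = B * (\<Sum>i<n. \<alpha> i * B ^ (n - Suc i)) + \<alpha> n"
proof -
  have "(\<Sum>i<n. \<alpha> i * B ^ (n - i)) = (\<Sum>i<n. B * (\<alpha> i * B ^ (n - Suc i)))"
    by (rule sum.cong) (auto simp: Suc_diff_Suc[symmetric] mult_ac)
  then show ?thesis by (simp add: sum_distrib_left)
qed

lemma sum_digits_less:
  fixes B :: nat
  assumes "\<forall>i<n. \<alpha> i < B"
  shows "(\<Sum>i<n. \<alpha> i * B ^ (n - Suc i)) < B ^ n"
  using assms
proof (induction n)
  case (Suc n)
  let ?s = "\<Sum>i<n. \<alpha> i * B ^ (n - Suc i)"
  have "Suc ?s \<le> B ^ n" using Suc by (simp add: Suc_leI)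
  then have "B * Suc ?s \<le> B * B ^ n" by (rule mult_le_mono2)
  moreover have "\<alpha> n < B" using Suc.prems by simp
  ultimately have "B * ?s + \<alpha> n < B ^ Suc n" by simp
  then show ?case using sum_digits_Suc[of \<alpha> B n] by simp
qed simp

lemma sum_digits_unique:
  fixes B :: nat
  assumes "\<forall>i<n. \<alpha> i < B" "\<forall>i<n. \<beta> i < B"
    and "(\<Sum>i<n. \<alpha> i * B ^ (n - Suc i)) = (\<Sum>i<n. \<beta> i * B ^ (n - Suc i))"
  shows "\<forall>i<n. \<alpha> i = \<beta> i"
  using assms
proof (induction n)
  case (Suc n)
  let ?s = "\<lambda>\<alpha>. \<Sum>i<n. \<alpha> i * B ^ (n - Suc i)"
  have eq: "B * ?s \<alpha> + \<alpha> n = B * ?s \<beta> + \<beta> n"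
    using Suc.prems(3) sum_digits_Suc[of \<alpha> B n] sum_digits_Suc[of \<beta> B n] by simp
  have less: "\<alpha> n < B" "\<beta> n < B" using Suc.prems by simp_all
  have "\<alpha> n = \<beta> n" using arg_cong[OF eq, of "\<lambda>m. m mod B"] less by simp
  moreover from this eq less have "?s \<alpha> = ?s \<beta>" by simp
  with Suc have "\<forall>i<n. \<alpha> i = \<beta> i" by simp
  ultimately show ?case by (simp add: less_Suc_eq)
qed simp

text \<open>The weight \<open>\<Sum>i<n. \<alpha> i * v i\<close> is a substitute for a monomial order: it is additive and takes values
in the natural numbers. It need not separate all multi-indices: only the finitely many in the supports
of two given elements matter. With \<open>v i = B ^ n + B ^ (n - 1 - i)\<close> and \<open>B\<close> above all entries, the
weight is \<open>|\<alpha>| * B ^ n\<close> plus a remainder below \<open>B ^ n\<close> that has the entries of \<open>\<alpha>\<close> as its digits. The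
first two conditions on \<open>v\<close> are those under which the commutation relations respect the weight.\<close>

lemma separating_weights_exist:
  assumes "finite S" "S \<subseteq> multi_indices n"
  obtains v :: "nat \<Rightarrow> nat" where
    "\<And>i j. i < j \<Longrightarrow> j < n \<Longrightarrow> v j \<le> v i"
    "\<And>i j k. i < n \<Longrightarrow> j < n \<Longrightarrow> k < n \<Longrightarrow> v k < v i + v j"
    "inj_on (\<lambda>\<alpha>. \<Sum>i<n. \<alpha> i * v i) S"
proof -
  define T where "T = (\<lambda>(\<alpha>, i). \<alpha> i) ` (S \<times> {..<n})"
  define B where "B = Suc (Max (insert 0 T))"
  have "finite T" using assms(1) by (simp add: T_def)
  moreover have "\<alpha> i \<in> T" if "\<alpha> \<in> S" "i < n" for \<alpha> i
    unfolding T_def using that by (intro image_eqI[of _ _ "(\<alpha>, i)"]) auto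
  ultimately have B: "\<alpha> i < B" if "\<alpha> \<in> S" "i < n" for \<alpha> i
    unfolding B_def using that by (simp add: less_Suc_eq_le)
  have B0: "0 < B" by (simp add: B_def)
  define v where "v i = B ^ n + B ^ (n - Suc i)" for i
  show ?thesis
  proof (rule that[of v])
    show "v j \<le> v i" if "i < j" "j < n" for i j
      unfolding v_def using that B0 by (simp add: power_increasing)
    show "v k < v i + v j" if "i < n" "j < n" "k < n" for i j k
    proof -
      have "B ^ (n - Suc k) \<le> B ^ n" using B0 by (simp add: power_increasing)
      moreover have "0 < B ^ (n - Suc i)" using B0 by simp
      ultimately show ?thesis unfolding v_def by linarith
    qed
    have weight: "(\<Sum>i<n. \<alpha> i * v i) mod B ^ n = (\<Sum>i<n. \<alpha> i * B ^ (n - Suc i))" if "\<alpha> \<in> S" for \<alpha>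
    proof -
      have "(\<Sum>i<n. \<alpha> i * v i) = (\<Sum>i<n. \<alpha> i) * B ^ n + (\<Sum>i<n. \<alpha> i * B ^ (n - Suc i))"
        by (simp add: v_def distrib_left sum.distrib sum_distrib_right)
      then show ?thesis using sum_digits_less[of n \<alpha> B] B that by simp
    qed
    show "inj_on (\<lambda>\<alpha>. \<Sum>i<n. \<alpha> i * v i) S"
    proof (rule inj_onI)
      fix \<alpha> \<beta> assume S: "\<alpha> \<in> S" "\<beta> \<in> S" and eq: "(\<Sum>i<n. \<alpha> i * v i) = (\<Sum>i<n. \<beta> i * v i)"
      have "\<forall>i<n. \<alpha> i = \<beta> i"
        by (rule sum_digits_unique[of n \<alpha> B \<beta>]) (use B S weight[OF S(1)] weight[OF S(2)] eq in auto)
      moreover have "\<forall>i\<ge>n. \<alpha> i = \<beta> i" using subsetD[OF assms(2) S(1)] subsetD[OF assms(2) S(2)] by (simp add: multi_indices_def)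
      ultimately show "\<alpha> = \<beta>" by (intro ext) (meson not_le)
    qed
  qed
qed

section \<open>Coefficients in a skew PBW extension\<close>

lemma (in abelian_monoid) finsum_in_submonoid:
  assumes "V \<subseteq> carrier G" "\<zero> \<in> V" "\<And>u v. u \<in> V \<Longrightarrow> v \<in> V \<Longrightarrow> u \<oplus> v \<in> V"
    and "\<And>i. i \<in> I \<Longrightarrow> g i \<in> V"
  shows "finsum G g I \<in> V"
  using assms(4)
proof (induction I rule: infinite_finite_induct)
  case (insert i I)
  moreover from insert.prems assms(1) have "g \<in> I \<rightarrow> carrier G" "g i \<in> carrier G" by auto
  ultimately show ?case using assms(3) by simp
qed (use assms(2) in \<open>simp_all add: finsum_infinite\<close>)

context ring begin

abbreviation ordered_power_product :: "(nat \<Rightarrow> 'a) \<Rightarrow> (nat \<Rightarrow> nat) \<Rightarrow> nat list \<Rightarrow> 'a" where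
  "ordered_power_product x \<alpha> js \<equiv> foldr (\<lambda>i y. (x i [^] \<alpha> i) \<otimes> y) js \<one>"

lemma ordered_power_product_closed:
  "(\<And>i. i \<in> set js \<Longrightarrow> x i \<in> carrier R) \<Longrightarrow> ordered_power_product x \<alpha> js \<in> carrier R"
  by (induction js) auto

lemma ordered_power_product_skip:
  assumes "\<And>i. i \<in> set is \<Longrightarrow> \<alpha> i = (0::nat)" "\<And>i. i \<in> set js \<Longrightarrow> x i \<in> carrier R"
  shows "ordered_power_product x \<alpha> (is @ js) = ordered_power_product x \<alpha> js"
  using assms(1) by (induction "is") (auto simp: ordered_power_product_closed assms(2))

lemma monomial_closed:
  "(\<And>i. i < n \<Longrightarrow> x i \<in> carrier R) \<Longrightarrow> monomial R n x \<alpha> \<in> carrier R"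
  unfolding monomial_def by (rule ordered_power_product_closed) auto

lemma monomial_zero:
  assumes "\<And>i. i < n \<Longrightarrow> x i \<in> carrier R"
  shows "monomial R n x (\<lambda>_. 0) = \<one>"
  unfolding monomial_def using ordered_power_product_skip[of "[0..<n]" "\<lambda>_. 0" "[]" x] by simp

text \<open>No commutation is involved here, as \<open>x\<^sub>j\<close> only meets trivial powers on its way to its place.\<close>

lemma var_mult_monomial:
  assumes x: "\<And>i. i < n \<Longrightarrow> x i \<in> carrier R"
    and j: "j < n" "\<forall>i<j. \<alpha> i = 0"
  shows "x j \<otimes> monomial R n x \<alpha> = monomial R n x (inc j \<alpha>)"
proof -
  define rest where "rest = ordered_power_product x \<alpha> [Suc j..<n]"
  have rest: "rest \<in> carrier R"
    unfolding rest_def by (rule ordered_power_product_closed) (use x in auto)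
  have split: "[0..<n] = [0..<j] @ j # [Suc j..<n]"
    using j(1) upt_add_eq_append[of 0 j "n - j"] by (simp add: upt_conv_Cons)
  have eq: "monomial R n x \<beta> = (x j [^] \<beta> j) \<otimes> ordered_power_product x \<beta> [Suc j..<n]"
    if "\<forall>i<j. \<beta> i = 0" for \<beta>
    unfolding monomial_def split
    by (subst ordered_power_product_skip) (use that x j(1) in auto)
  have "ordered_power_product x (inc j \<alpha>) [Suc j..<n] = rest"
    unfolding rest_def by (rule foldr_cong) (auto simp: inc_apply)
  then have "monomial R n x (inc j \<alpha>) = (x j [^] Suc (\<alpha> j)) \<otimes> rest"
    using eq[of "inc j \<alpha>"] j(2) by (simp add: inc_apply)
  also have "\<dots> = x j \<otimes> ((x j [^] \<alpha> j) \<otimes> rest)"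
    unfolding nat_pow_Suc2[OF x[OF j(1)]] using x[OF j(1)] rest by (simp add: m_assoc)
  also have "\<dots> = x j \<otimes> monomial R n x \<alpha>" using eq[of \<alpha>] j(2) by (simp add: rest_def)
  finally show ?thesis ..
qed

end

locale skew_pbw = ring A for A :: "('a, 'b) ring_scheme" (structure) +
  fixes R :: "('a, 'b) ring_scheme" and n :: nat and x :: "nat \<Rightarrow> 'a"
    and \<sigma> \<delta> :: "nat \<Rightarrow> 'a \<Rightarrow> 'a"
  assumes extension: "skew_pbw_extension R A n x"
    and maps: "skew_pbw_maps R A n x \<sigma> \<delta>"
begin

lemma base_eq: "R = A\<lparr>carrier := carrier R\<rparr>" and base_subring: "subring (carrier R) A"
  using extension by (auto simp: skew_pbw_extension_def is_subring_of_def)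

lemma base_ops [simp]:
  "(\<otimes>\<^bsub>R\<^esub>) = (\<otimes>)" "(\<oplus>\<^bsub>R\<^esub>) = (\<oplus>)" "\<zero>\<^bsub>R\<^esub> = \<zero>" "\<one>\<^bsub>R\<^esub> = \<one>"
  by (subst base_eq, simp)+

lemma base_ring: "ring R"
  using subring_is_ring[OF base_subring] base_eq by metis

lemma base_pow [simp]: "a [^]\<^bsub>R\<^esub> (k::nat) = a [^] k"
  by (subst base_eq) (simp add: nat_pow_def)

lemma base_in [simp]: "r \<in> carrier R \<Longrightarrow> r \<in> carrier A"
  using subringE(1)[OF base_subring] by auto

lemma base_closed [simp]:
  "\<zero> \<in> carrier R" "\<one> \<in> carrier R"
  "r \<in> carrier R \<Longrightarrow> s \<in> carrier R \<Longrightarrow> r \<oplus> s \<in> carrier R"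
  "r \<in> carrier R \<Longrightarrow> s \<in> carrier R \<Longrightarrow> r \<otimes> s \<in> carrier R"
  "r \<in> carrier R \<Longrightarrow> \<ominus> r \<in> carrier R"
  using subringE[OF base_subring] by auto

lemma var_closed [simp]: "i < n \<Longrightarrow> x i \<in> carrier A"
  using extension by (auto simp: skew_pbw_extension_def)

lemma maps_closed [simp]:
  "i < n \<Longrightarrow> r \<in> carrier R \<Longrightarrow> \<sigma> i r \<in> carrier R"
  "i < n \<Longrightarrow> r \<in> carrier R \<Longrightarrow> \<delta> i r \<in> carrier R"
  using maps by (auto simp: skew_pbw_maps_def skew_derivation_def ring_hom_def)

lemma var_commute:
  "i < n \<Longrightarrow> r \<in> carrier R \<Longrightarrow> x i \<otimes> r = \<sigma> i r \<otimes> x i \<oplus> \<delta> i r"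
  using maps by (auto simp: skew_pbw_maps_def)

abbreviation mon :: "(nat \<Rightarrow> nat) \<Rightarrow> 'a" where "mon \<equiv> monomial A n x"

lemma mon_closed [simp]: "mon \<alpha> \<in> carrier A" by (rule monomial_closed) simp

lemma mon_zero [simp]: "mon (\<lambda>_. 0) = \<one>" by (rule monomial_zero) simp

lemma var_mult_mon: "j < n \<Longrightarrow> \<forall>i<j. \<alpha> i = 0 \<Longrightarrow> x j \<otimes> mon \<alpha> = mon (inc j \<alpha>)"
  by (rule var_mult_monomial) auto

definition coef :: "'a \<Rightarrow> (nat \<Rightarrow> nat) \<Rightarrow> 'a" where
  "coef f = (THE c. c \<in> left_coeffs R n \<and> f = left_combination A n x c)"

definition supp :: "'a \<Rightarrow> (nat \<Rightarrow> nat) set" where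
  "supp f = {\<alpha>. coef f \<alpha> \<noteq> \<zero>}"

lemma left_combination_closed:
  "c \<in> left_coeffs R n \<Longrightarrow> left_combination A n x c \<in> carrier A"
  unfolding left_combination_def by (rule finsum_closed) (auto simp: left_coeffs_def)

lemma coef_props:
  assumes "f \<in> carrier A"
  shows "coef f \<in> left_coeffs R n" "left_combination A n x (coef f) = f"
proof -
  have "\<exists>!c. c \<in> left_coeffs R n \<and> f = left_combination A n x c"
    using extension assms by (auto simp: skew_pbw_extension_def free_left_on_monomials_def)
  from theI'[OF this] show "coef f \<in> left_coeffs R n" "left_combination A n x (coef f) = f"
    unfolding coef_def by auto
qed

lemma coef_eqI:
  assumes "c \<in> left_coeffs R n" "left_combination A n x c = f"
  shows "coef f = c"
proof -
  have "f \<in> carrier A" using left_combination_closed assms by auto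
  then have "\<exists>!c. c \<in> left_coeffs R n \<and> f = left_combination A n x c"
    using extension by (auto simp: skew_pbw_extension_def free_left_on_monomials_def)
  then show ?thesis using assms coef_props[OF \<open>f \<in> carrier A\<close>] by metis
qed

lemma coef_closed [simp]: "f \<in> carrier A \<Longrightarrow> coef f \<alpha> \<in> carrier R"
  and coef_outside: "f \<in> carrier A \<Longrightarrow> \<alpha> \<notin> multi_indices n \<Longrightarrow> coef f \<alpha> = \<zero>"
  and finite_supp: "f \<in> carrier A \<Longrightarrow> finite (supp f)"
  using coef_props(1)[of f] by (auto simp: left_coeffs_def supp_def)

lemma supp_multi_indices: "f \<in> carrier A \<Longrightarrow> supp f \<subseteq> multi_indices n"
  using coef_outside by (auto simp: supp_def)

lemma left_combination_eq:
  assumes "finite S" "{\<alpha>. c \<alpha> \<noteq> \<zero>} \<subseteq> S" "\<And>\<alpha>. c \<alpha> \<in> carrier R"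
  shows "left_combination A n x c = (\<Oplus>\<alpha>\<in>S. c \<alpha> \<otimes> mon \<alpha>)"
  unfolding left_combination_def
  by (rule add.finprod_mono_neutral_cong_left) (use assms in auto)

lemma left_coeffsI:
  assumes "finite S" "S \<subseteq> multi_indices n" "{\<alpha>. c \<alpha> \<noteq> \<zero>} \<subseteq> S" "\<And>\<alpha>. c \<alpha> \<in> carrier R"
  shows "c \<in> left_coeffs R n"
  unfolding left_coeffs_def using assms finite_subset[OF assms(3,1)] by simp

lemma expansion_superset:
  assumes "f \<in> carrier A" "finite S" "supp f \<subseteq> S"
  shows "(\<Oplus>\<alpha>\<in>S. coef f \<alpha> \<otimes> mon \<alpha>) = f"
  using left_combination_eq[of S "coef f"] assms coef_props(2)[of f] by (simp add: supp_def)

lemma expansion: "f \<in> carrier A \<Longrightarrow> (\<Oplus>\<alpha>\<in>supp f. coef f \<alpha> \<otimes> mon \<alpha>) = f"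
  by (rule expansion_superset) (simp_all add: finite_supp)

lemma coef_add:
  assumes f: "f \<in> carrier A" and g: "g \<in> carrier A"
  shows "coef (f \<oplus> g) \<alpha> = coef f \<alpha> \<oplus> coef g \<alpha>"
proof -
  define c where "c = (\<lambda>\<alpha>. coef f \<alpha> \<oplus> coef g \<alpha>)"
  define S where "S = supp f \<union> supp g"
  have S: "finite S" "S \<subseteq> multi_indices n"
    using finite_supp supp_multi_indices f g by (auto simp: S_def)
  have sub: "{\<alpha>. c \<alpha> \<noteq> \<zero>} \<subseteq> S" by (auto simp: supp_def c_def S_def)
  have c: "c \<alpha> \<in> carrier R" for \<alpha> using f g by (simp add: c_def)
  have "left_combination A n x c = (\<Oplus>\<alpha>\<in>S. c \<alpha> \<otimes> mon \<alpha>)"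
    using left_combination_eq S(1) sub c .
  also have "\<dots> = (\<Oplus>\<alpha>\<in>S. coef f \<alpha> \<otimes> mon \<alpha> \<oplus> coef g \<alpha> \<otimes> mon \<alpha>)"
    by (rule finsum_cong') (use f g in \<open>simp_all add: l_distr c_def\<close>)
  also have "\<dots> = (\<Oplus>\<alpha>\<in>S. coef f \<alpha> \<otimes> mon \<alpha>) \<oplus> (\<Oplus>\<alpha>\<in>S. coef g \<alpha> \<otimes> mon \<alpha>)"
    by (rule finsum_addf) (use f g in auto)
  also have "\<dots> = f \<oplus> g"
    using expansion_superset[OF f S(1)] expansion_superset[OF g S(1)] by (simp add: S_def)
  finally show ?thesis using coef_eqI[OF left_coeffsI[OF S sub c]] unfolding c_def by metis
qed

lemma coef_smult:
  assumes r: "r \<in> carrier R" and f: "f \<in> carrier A"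
  shows "coef (r \<otimes> f) \<alpha> = r \<otimes> coef f \<alpha>"
proof -
  define c where "c = (\<lambda>\<alpha>. r \<otimes> coef f \<alpha>)"
  note S = finite_supp[OF f] supp_multi_indices[OF f]
  have sub: "{\<alpha>. c \<alpha> \<noteq> \<zero>} \<subseteq> supp f" using r by (auto simp: supp_def c_def)
  have c: "c \<alpha> \<in> carrier R" for \<alpha> using r f by (simp add: c_def)
  have "left_combination A n x c = (\<Oplus>\<alpha>\<in>supp f. c \<alpha> \<otimes> mon \<alpha>)"
    using left_combination_eq S(1) sub c .
  also have "\<dots> = (\<Oplus>\<alpha>\<in>supp f. r \<otimes> (coef f \<alpha> \<otimes> mon \<alpha>))"
    by (rule finsum_cong') (use r f in \<open>simp_all add: m_assoc c_def\<close>)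
  also have "\<dots> = r \<otimes> (\<Oplus>\<alpha>\<in>supp f. coef f \<alpha> \<otimes> mon \<alpha>)"
    by (rule finsum_rdistr[symmetric]) (use r f S in auto)
  also have "\<dots> = r \<otimes> f" using expansion[OF f] by simp
  finally show ?thesis using coef_eqI[OF left_coeffsI[OF S sub c]] unfolding c_def by metis
qed

lemma coef_mon:
  assumes "\<alpha> \<in> multi_indices n"
  shows "coef (mon \<alpha>) \<beta> = (if \<beta> = \<alpha> then \<one> else \<zero>)"
proof -
  let ?c = "\<lambda>\<beta>. if \<beta> = \<alpha> then \<one> else \<zero>"
  have sub: "{\<beta>. ?c \<beta> \<noteq> \<zero>} \<subseteq> {\<alpha>}" by auto
  have lc: "?c \<in> left_coeffs R n" by (rule left_coeffsI[OF _ _ sub]) (use assms in auto)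
  have "left_combination A n x ?c = (\<Oplus>\<beta>\<in>{\<alpha>}. ?c \<beta> \<otimes> mon \<beta>)"
    by (rule left_combination_eq) auto
  also have "\<dots> = mon \<alpha>" by simp
  finally show ?thesis using coef_eqI[OF lc] by metis
qed

lemma coef_zero [simp]: "coef \<zero> \<alpha> = \<zero>"
  using coef_smult[of \<zero> \<zero> \<alpha>] by simp

text \<open>To place a product \<open>f u\<close> in an additive submonoid, it suffices to treat the terms of \<open>f\<close> one by one;
likewise for \<open>u f\<close> below.\<close>

lemma mult_in_submonoid_left:
  assumes "f \<in> carrier A" "u \<in> carrier A"
    and V: "V \<subseteq> carrier A" "\<zero> \<in> V" "\<And>u v. u \<in> V \<Longrightarrow> v \<in> V \<Longrightarrow> u \<oplus> v \<in> V"
    and "\<And>\<gamma>. \<gamma> \<in> multi_indices n \<Longrightarrow> coef f \<gamma> \<otimes> (mon \<gamma> \<otimes> u) \<in> V"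
  shows "f \<otimes> u \<in> V"
proof -
  have "f \<otimes> u = (\<Oplus>\<gamma>\<in>supp f. coef f \<gamma> \<otimes> mon \<gamma>) \<otimes> u" using expansion assms(1) by simp
  also have "\<dots> = (\<Oplus>\<gamma>\<in>supp f. (coef f \<gamma> \<otimes> mon \<gamma>) \<otimes> u)"
    by (rule finsum_ldistr) (use assms finite_supp in auto)
  also have "\<dots> \<in> V"
    by (rule finsum_in_submonoid[OF V])
      (use assms supp_multi_indices[OF assms(1)] in \<open>auto simp: m_assoc\<close>)
  finally show ?thesis .
qed

lemma mult_in_submonoid_right:
  assumes "f \<in> carrier A" "u \<in> carrier A"
    and V: "V \<subseteq> carrier A" "\<zero> \<in> V" "\<And>u v. u \<in> V \<Longrightarrow> v \<in> V \<Longrightarrow> u \<oplus> v \<in> V"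
    and "\<And>\<gamma>. \<gamma> \<in> multi_indices n \<Longrightarrow> u \<otimes> (coef f \<gamma> \<otimes> mon \<gamma>) \<in> V"
  shows "u \<otimes> f \<in> V"
proof -
  have "u \<otimes> f = u \<otimes> (\<Oplus>\<gamma>\<in>supp f. coef f \<gamma> \<otimes> mon \<gamma>)" using expansion assms(1) by simp
  also have "\<dots> = (\<Oplus>\<gamma>\<in>supp f. u \<otimes> (coef f \<gamma> \<otimes> mon \<gamma>))"
    by (rule finsum_rdistr) (use assms finite_supp in auto)
  also have "\<dots> \<in> V"
    by (rule finsum_in_submonoid[OF V])
      (use assms supp_multi_indices[OF assms(1)] in auto)
  finally show ?thesis .
qed

lemma var_smult_mon:
  assumes "i < n" "r \<in> carrier R" "u \<in> carrier A"
  shows "x i \<otimes> (r \<otimes> u) = \<sigma> i r \<otimes> (x i \<otimes> u) \<oplus> \<delta> i r \<otimes> u"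
proof -
  have "x i \<otimes> (r \<otimes> u) = (x i \<otimes> r) \<otimes> u" using assms by (simp add: m_assoc)
  also have "\<dots> = \<sigma> i r \<otimes> (x i \<otimes> u) \<oplus> \<delta> i r \<otimes> u"
    using assms by (simp add: var_commute l_distr m_assoc)
  finally show ?thesis .
qed

end

section \<open>Commuting two variables\<close>

context skew_pbw begin

definition affine_part :: "'a \<Rightarrow> (nat \<Rightarrow> 'a) \<Rightarrow> 'a" where
  "affine_part r t = r \<oplus> (\<Oplus>k\<in>{..<n}. t k \<otimes> x k)"

lemma affine_part_closed:
  assumes "r \<in> carrier R" "t \<in> {..<n} \<rightarrow> carrier R"
  shows "affine_part r t \<in> carrier A"
proof -
  have "t k \<otimes> x k \<in> carrier A" if "k < n" for k
    using base_in[OF funcset_mem[OF assms(2), of k]] that by simp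
  then show ?thesis unfolding affine_part_def using assms(1) by (auto intro!: finsum_closed)
qed

lemma affine_part_mult_in_submonoid:
  assumes "r \<in> carrier R" "t \<in> {..<n} \<rightarrow> carrier R" "u \<in> carrier A"
    and V: "V \<subseteq> carrier A" "\<zero> \<in> V" "\<And>u v. u \<in> V \<Longrightarrow> v \<in> V \<Longrightarrow> u \<oplus> v \<in> V"
    and "r \<otimes> u \<in> V" "\<And>k. k < n \<Longrightarrow> t k \<otimes> (x k \<otimes> u) \<in> V"
  shows "affine_part r t \<otimes> u \<in> V"
proof -
  have t: "t k \<in> carrier A" if "k < n" for k
    by (rule base_in[OF funcset_mem[OF assms(2)]]) (use that in simp)
  have "affine_part r t \<otimes> u = r \<otimes> u \<oplus> (\<Oplus>k\<in>{..<n}. t k \<otimes> x k) \<otimes> u"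
    unfolding affine_part_def using assms(1,3) t by (intro l_distr) (auto intro!: finsum_closed)
  also have "(\<Oplus>k\<in>{..<n}. t k \<otimes> x k) \<otimes> u = (\<Oplus>k\<in>{..<n}. (t k \<otimes> x k) \<otimes> u)"
    by (rule finsum_ldistr) (use assms(3) t in auto)
  also have "\<dots> = (\<Oplus>k\<in>{..<n}. t k \<otimes> (x k \<otimes> u))"
    by (rule finsum_cong') (use assms(3) t in \<open>auto simp: m_assoc\<close>)
  also have "r \<otimes> u \<oplus> \<dots> \<in> V"
    by (intro V(3) assms(7) finsum_in_submonoid[OF V]) (use assms(8) in auto)
  finally show ?thesis .
qed

lemma commutation_relation:
  assumes "i < n" "j < n"
  obtains d r t where "d \<in> carrier R" "r \<in> carrier R" "t \<in> {..<n} \<rightarrow> carrier R"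
    "x i \<otimes> x j = d \<otimes> (x j \<otimes> x i) \<oplus> affine_part r t"
proof -
  have "\<forall>i<n. \<forall>j<n. \<exists>d\<in>carrier R - {\<zero>}. \<exists>r\<in>carrier R. \<exists>t\<in>{..<n} \<rightarrow> carrier R.
      x j \<otimes> x i \<ominus> d \<otimes> x i \<otimes> x j = affine_part r t"
    using extension unfolding skew_pbw_extension_def affine_part_def base_ops by (elim conjE) assumption
  with assms obtain d r t where d: "d \<in> carrier R" and rt: "r \<in> carrier R" "t \<in> {..<n} \<rightarrow> carrier R"
    and eq: "x i \<otimes> x j \<ominus> d \<otimes> x j \<otimes> x i = affine_part r t"
    by blast
  have "x i \<otimes> x j = d \<otimes> (x j \<otimes> x i) \<oplus> (x i \<otimes> x j \<ominus> d \<otimes> (x j \<otimes> x i))"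
    using assms d by (simp add: a_ac minus_eq r_neg r_neg1 r_neg2)
  also have "x i \<otimes> x j \<ominus> d \<otimes> (x j \<otimes> x i) = affine_part r t"
    using eq assms d by (simp add: m_assoc)
  finally show ?thesis using d rt that by blast
qed

text \<open>The error term in the commutation relation of two variables has total degree at most one.\<close>

lemma coef_affine_part:
  assumes "r \<in> carrier R" "t \<in> {..<n} \<rightarrow> carrier R"
    and "\<gamma> \<noteq> (\<lambda>_. 0)" "\<And>k. k < n \<Longrightarrow> \<gamma> \<noteq> inc k (\<lambda>_. 0)"
  shows "coef (affine_part r t) \<gamma> = \<zero>"
proof -
  let ?V = "{f \<in> carrier A. coef f \<gamma> = \<zero>}"
  have x: "x k = mon (inc k (\<lambda>_. 0))" if "k < n" for k
    using var_mult_mon[OF that, of "\<lambda>_. 0"] that by simp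
  have t: "t k \<in> carrier R" if "k < n" for k using that assms(2) by auto
  have "coef (r \<otimes> \<one>) \<gamma> = \<zero>"
    using coef_smult[OF assms(1), of \<one> \<gamma>] coef_mon[of "\<lambda>_. 0" \<gamma>] assms(1,3) by simp
  moreover have "coef (t k \<otimes> x k) \<gamma> = \<zero>" if "k < n" for k
    using coef_smult[OF t[OF that] var_closed[OF that], of \<gamma>] x[OF that] assms(4)[OF that] t[OF that]
      coef_mon[of "inc k (\<lambda>_. 0)" \<gamma>] that by simp
  ultimately have "affine_part r t \<otimes> \<one> \<in> ?V"
    by (intro affine_part_mult_in_submonoid) (use assms t in \<open>auto simp: coef_add\<close>)
  then show ?thesis using affine_part_closed[OF assms(1,2)] by simp
qed

text \<open>The coefficient \<open>d\<close> in \<open>x\<^sub>i x\<^sub>j = d x\<^sub>j x\<^sub>i + \<dots>\<close> is only given as nonzero, which would not keep it out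
of an ideal. It is left invertible: the relation for the pair in the other order reads
\<open>x\<^sub>j x\<^sub>i = e x\<^sub>i x\<^sub>j + \<dots>\<close>, and substituting one into the other and comparing the coefficients of the
basis element \<open>x\<^sub>j x\<^sub>i\<close> yields \<open>1 = e d\<close>.\<close>

lemma commutation_relation_invertible:
  assumes "j < i" "i < n"
  obtains d e r t where "d \<in> carrier R" "e \<in> carrier R" "e \<otimes> d = \<one>"
    "r \<in> carrier R" "t \<in> {..<n} \<rightarrow> carrier R"
    "x i \<otimes> x j = d \<otimes> (x j \<otimes> x i) \<oplus> affine_part r t"
proof -
  have j: "j < n" using assms by simp
  obtain d r t where d: "d \<in> carrier R" and rt: "r \<in> carrier R" "t \<in> {..<n} \<rightarrow> carrier R"
    and eq: "x i \<otimes> x j = d \<otimes> (x j \<otimes> x i) \<oplus> affine_part r t"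
    using commutation_relation[OF assms(2) j] by blast
  obtain e r' t' where e: "e \<in> carrier R" and rt': "r' \<in> carrier R" "t' \<in> {..<n} \<rightarrow> carrier R"
    and eq': "x j \<otimes> x i = e \<otimes> (x i \<otimes> x j) \<oplus> affine_part r' t'"
    using commutation_relation[OF j assms(2)] by blast
  define \<gamma> where "\<gamma> = inc j (inc i (\<lambda>_. 0))"
  have \<gamma>: "\<gamma> \<in> multi_indices n" using assms j by (simp add: \<gamma>_def)
  have "\<gamma> \<noteq> (\<lambda>_. 0)" by (auto simp: \<gamma>_def fun_eq_iff inc_apply)
  moreover have "\<gamma> \<noteq> inc k (\<lambda>_. 0)" for k
  proof
    assume "\<gamma> = inc k (\<lambda>_. 0)"
    then have "\<gamma> i = inc k (\<lambda>_. 0) i" "\<gamma> j = inc k (\<lambda>_. 0) j" by simp_all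
    then show False using assms(1) by (auto simp: \<gamma>_def inc_apply split: if_splits)
  qed
  ultimately have zero: "coef (affine_part r t) \<gamma> = \<zero>" "coef (affine_part r' t') \<gamma> = \<zero>"
    using coef_affine_part rt rt' by blast+
  have "x j \<otimes> (x i \<otimes> mon (\<lambda>_. 0)) = mon \<gamma>"
    unfolding \<gamma>_def using assms j
    by (simp add: var_mult_mon inc_apply del: mon_zero)
  then have mon: "x j \<otimes> x i = mon \<gamma>" using assms by simp
  have closed: "x i \<otimes> x j \<in> carrier A" "x j \<otimes> x i \<in> carrier A" using assms j by simp_all
  have "\<one> = coef (x j \<otimes> x i) \<gamma>" using mon coef_mon[OF \<gamma>, of \<gamma>] by simp
  also have "\<dots> = e \<otimes> coef (x i \<otimes> x j) \<gamma>"
    unfolding eq' using coef_add coef_smult[OF e] zero closed affine_part_closed[OF rt'] e by simp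
  also have "coef (x i \<otimes> x j) \<gamma> = d \<otimes> coef (x j \<otimes> x i) \<gamma>"
    unfolding eq using coef_add coef_smult[OF d] zero closed affine_part_closed[OF rt] d by simp
  also have "coef (x j \<otimes> x i) \<gamma> = \<one>" using mon coef_mon[OF \<gamma>, of \<gamma>] by simp
  finally have "e \<otimes> d = \<one>" using d by simp
  then show ?thesis using that d e rt eq by blast
qed

end

section \<open>Extending a completely prime ideal of coefficients\<close>

text \<open>These are the conditions under which the relations \<open>x\<^sub>i r = \<sigma>\<^sub>i(r) x\<^sub>i + \<delta>\<^sub>i(r)\<close> pass to coefficients
in the domain \<open>R / P\<close>, with \<open>\<sigma>\<^sub>i\<close> still injective there.\<close>

locale skew_pbw_prime = skew_pbw +
  fixes P :: "'a set"
  assumes P_ideal: "ideal P R"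
    and P_proper: "\<one> \<notin> P"
    and P_prime: "\<And>a b. a \<in> carrier R \<Longrightarrow> b \<in> carrier R \<Longrightarrow> a \<otimes> b \<in> P \<Longrightarrow> a \<in> P \<or> b \<in> P"
    and P_sigma: "\<And>i a. i < n \<Longrightarrow> a \<in> carrier R \<Longrightarrow> \<sigma> i a \<in> P \<longleftrightarrow> a \<in> P"
    and P_delta: "\<And>i a. i < n \<Longrightarrow> a \<in> P \<Longrightarrow> \<delta> i a \<in> P"
begin

lemma P_in [simp]: "a \<in> P \<Longrightarrow> a \<in> carrier R"
  using P_ideal ideal.Icarr by fastforce

lemma P_zero [simp]: "\<zero> \<in> P"
  using additive_subgroup.zero_closed[OF ideal.axioms(1)[OF P_ideal]] by simp

lemma P_add [simp]: "a \<in> P \<Longrightarrow> b \<in> P \<Longrightarrow> a \<oplus> b \<in> P"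
  using additive_subgroup.a_closed[OF ideal.axioms(1)[OF P_ideal]] by simp

lemma P_lmult [simp]: "a \<in> P \<Longrightarrow> r \<in> carrier R \<Longrightarrow> r \<otimes> a \<in> P"
  and P_rmult [simp]: "a \<in> P \<Longrightarrow> r \<in> carrier R \<Longrightarrow> a \<otimes> r \<in> P"
  using ideal.I_l_closed[OF P_ideal] ideal.I_r_closed[OF P_ideal] by simp_all

lemma P_add_cancel:
  assumes "a \<in> carrier R" "b \<in> P"
  shows "a \<oplus> b \<in> P \<longleftrightarrow> a \<in> P"
proof
  assume ab: "a \<oplus> b \<in> P"
  have "(\<ominus> \<one>) \<otimes> b \<in> P" using assms by simp
  then have "(a \<oplus> b) \<oplus> (\<ominus> \<one>) \<otimes> b \<in> P" using P_add[OF ab] by blast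
  also have "(a \<oplus> b) \<oplus> (\<ominus> \<one>) \<otimes> b = a"
    using assms by (simp add: l_minus a_assoc r_neg)
  finally show "a \<in> P" .
qed (use assms in simp)

lemma left_invertible_notin_P:
  "d \<in> carrier R \<Longrightarrow> e \<in> carrier R \<Longrightarrow> e \<otimes> d = \<one> \<Longrightarrow> d \<notin> P"
  using P_lmult[of d e] P_proper by auto

text \<open>The ideal \<open>P A\<close> of \<open>A\<close>.\<close>

definition extended_ideal :: "'a set" where
  "extended_ideal = {f \<in> carrier A. \<forall>\<gamma>. coef f \<gamma> \<in> P}"

lemma extended_ideal_add:
  "f \<in> extended_ideal \<Longrightarrow> g \<in> extended_ideal \<Longrightarrow> f \<oplus> g \<in> extended_ideal"
  by (simp add: extended_ideal_def coef_add)

lemma extended_ideal_zero: "\<zero> \<in> extended_ideal"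
  by (simp add: extended_ideal_def)

lemma extended_ideal_sub: "extended_ideal \<subseteq> carrier A"
  by (auto simp: extended_ideal_def)

lemmas extended_ideal_submonoid =
  extended_ideal_sub extended_ideal_zero extended_ideal_add

lemma extended_ideal_smult:
  "r \<in> carrier R \<Longrightarrow> f \<in> extended_ideal \<Longrightarrow> r \<otimes> f \<in> extended_ideal"
  by (simp add: extended_ideal_def coef_smult)

lemma P_mult_in_extended_ideal:
  "a \<in> P \<Longrightarrow> f \<in> carrier A \<Longrightarrow> a \<otimes> f \<in> extended_ideal"
  by (simp add: extended_ideal_def coef_smult)

lemma extended_ideal_rmult:
  assumes "f \<in> extended_ideal" "g \<in> carrier A"
  shows "f \<otimes> g \<in> extended_ideal"
  by (rule mult_in_submonoid_left[OF _ _ extended_ideal_submonoid])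
    (use assms P_mult_in_extended_ideal in \<open>auto simp: extended_ideal_def\<close>)

text \<open>The stability of \<open>P\<close> under \<open>\<sigma> i\<close> and \<open>\<delta> i\<close> is what makes \<open>P A\<close> a left ideal.\<close>

lemma var_mult_extended_ideal:
  assumes "i < n" "f \<in> extended_ideal"
  shows "x i \<otimes> f \<in> extended_ideal"
proof (rule mult_in_submonoid_right[OF _ _ extended_ideal_submonoid])
  fix \<gamma>
  have c: "coef f \<gamma> \<in> P" using assms(2) by (simp add: extended_ideal_def)
  have "\<sigma> i (coef f \<gamma>) \<otimes> (x i \<otimes> mon \<gamma>) \<oplus> \<delta> i (coef f \<gamma>) \<otimes> mon \<gamma> \<in> extended_ideal"
    by (intro extended_ideal_add P_mult_in_extended_ideal) (use assms(1) c P_sigma P_delta in auto)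
  then show "x i \<otimes> (coef f \<gamma> \<otimes> mon \<gamma>) \<in> extended_ideal"
    using var_smult_mon[OF assms(1) P_in[OF c], of "mon \<gamma>"] by simp
qed (use assms in \<open>auto simp: extended_ideal_def\<close>)

lemma extended_ideal_lmult:
  assumes "f \<in> carrier A" "g \<in> extended_ideal"
  shows "f \<otimes> g \<in> extended_ideal"
proof (rule mult_in_submonoid_left[OF _ _ extended_ideal_submonoid])
  have g: "g \<in> carrier A" using assms(2) extended_ideal_sub by auto
  fix \<gamma> assume "\<gamma> \<in> multi_indices n"
  then have "mon \<gamma> \<otimes> g \<in> extended_ideal"
  proof (induction rule: multi_index_induct)
    case (inc \<alpha> j)
    then have "mon (inc j \<alpha>) \<otimes> g = x j \<otimes> (mon \<alpha> \<otimes> g)"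
      using g by (simp add: var_mult_mon[symmetric] m_assoc)
    then show ?case using var_mult_extended_ideal inc by simp
  qed (use assms(2) g in simp)
  then show "coef f \<gamma> \<otimes> (mon \<gamma> \<otimes> g) \<in> extended_ideal"
    using extended_ideal_smult assms(1) by simp
qed (use assms extended_ideal_sub in auto)

end

section \<open>Leading terms\<close>

text \<open>Moving \<open>x\<^sub>i\<close> past \<open>x\<^sub>j\<close> produces terms of degree at most one, which \<open>v_sum\<close> makes lower than \<open>x\<^sub>i x\<^sub>j\<close>. The
monotonicity of \<open>v\<close> enters in the induction of \<open>var_mult_mon_leading\<close>.\<close>

locale weighted_skew_pbw_prime = skew_pbw_prime +
  fixes v :: "nat \<Rightarrow> nat"
  assumes v_antimono: "\<And>i j. i < j \<Longrightarrow> j < n \<Longrightarrow> v j \<le> v i"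
    and v_sum: "\<And>i j k. i < n \<Longrightarrow> j < n \<Longrightarrow> k < n \<Longrightarrow> v k < v i + v j"
begin

definition weight :: "(nat \<Rightarrow> nat) \<Rightarrow> nat" where
  "weight \<alpha> = (\<Sum>i<n. \<alpha> i * v i)"

lemma weight_inc [simp]: "i < n \<Longrightarrow> weight (inc i \<alpha>) = weight \<alpha> + v i"
proof -
  assume i: "i < n"
  have "(\<Sum>k<n. if k = i then v i else 0) = v i" using i by simp
  moreover have "weight (inc i \<alpha>) = (\<Sum>k<n. \<alpha> k * v k + (if k = i then v i else 0))"
    unfolding weight_def by (rule sum.cong) (auto simp: inc_apply)
  ultimately show ?thesis by (simp add: weight_def sum.distrib)
qed

lemma v_pos: "i < n \<Longrightarrow> 0 < v i"
  using v_sum[of i i i] by simp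

text \<open>Both notions are taken modulo \<open>P A\<close>. An element is in \<open>lower m\<close> if modulo \<open>P A\<close> all its monomials
have weight below \<open>m\<close>. It is in \<open>leading \<alpha>\<close> if modulo \<open>P A\<close> the monomial \<open>x\<^sup>\<alpha>\<close> is its only one of
maximal weight.\<close>

definition lower :: "nat \<Rightarrow> 'a set" where
  "lower m = {f \<in> carrier A. \<forall>\<gamma>. m \<le> weight \<gamma> \<longrightarrow> coef f \<gamma> \<in> P}"

definition leading :: "(nat \<Rightarrow> nat) \<Rightarrow> 'a set" where
  "leading \<alpha> = {f \<in> carrier A. coef f \<alpha> \<notin> P \<and>
     (\<forall>\<gamma>. \<gamma> \<noteq> \<alpha> \<longrightarrow> weight \<alpha> \<le> weight \<gamma> \<longrightarrow> coef f \<gamma> \<in> P)}"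

lemma lower_sub: "lower m \<subseteq> carrier A" and lower_zero: "\<zero> \<in> lower m"
  by (auto simp: lower_def)

lemma lower_add: "f \<in> lower m \<Longrightarrow> g \<in> lower m \<Longrightarrow> f \<oplus> g \<in> lower m"
  by (simp add: lower_def coef_add)

lemmas lower_submonoid = lower_sub lower_zero lower_add

lemma lower_smult: "r \<in> carrier R \<Longrightarrow> f \<in> lower m \<Longrightarrow> r \<otimes> f \<in> lower m"
  by (simp add: lower_def coef_smult)

lemma lower_mono: "m \<le> m' \<Longrightarrow> f \<in> lower m \<Longrightarrow> f \<in> lower m'"
  by (auto simp: lower_def)

lemma extended_ideal_lower: "f \<in> extended_ideal \<Longrightarrow> f \<in> lower m"
  by (auto simp: lower_def extended_ideal_def)

lemma leading_closed: "f \<in> leading \<alpha> \<Longrightarrow> f \<in> carrier A"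
  by (simp add: leading_def)

lemma leading_lower: "f \<in> leading \<alpha> \<Longrightarrow> weight \<alpha> < m \<Longrightarrow> f \<in> lower m"
  unfolding lower_def leading_def by clarify (metis leD less_imp_le order_less_le_trans)

lemma leading_add_lower:
  "f \<in> leading \<alpha> \<Longrightarrow> g \<in> lower (weight \<alpha>) \<Longrightarrow> f \<oplus> g \<in> leading \<alpha>"
  by (simp add: lower_def leading_def coef_add P_add_cancel)

text \<open>Here complete primeness of \<open>P\<close> is used: the leading coefficient stays outside \<open>P\<close>.\<close>

lemma leading_smult:
  assumes "r \<in> carrier R" "r \<notin> P" "f \<in> leading \<alpha>"
  shows "r \<otimes> f \<in> leading \<alpha>"
  using assms P_prime[of r "coef f \<alpha>"] by (auto simp: leading_def coef_smult)

lemma mon_leading: "\<alpha> \<in> multi_indices n \<Longrightarrow> mon \<alpha> \<in> leading \<alpha>"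
  by (simp add: leading_def coef_mon P_proper)

lemma leading_split:
  assumes "f \<in> leading \<alpha>"
  obtains a h where "a \<in> carrier R" "a \<notin> P" "\<alpha> \<in> multi_indices n" "h \<in> lower (weight \<alpha>)"
    "f = a \<otimes> mon \<alpha> \<oplus> h"
proof -
  have f: "f \<in> carrier A" using assms by (rule leading_closed)
  define a where "a = coef f \<alpha>"
  have a: "a \<in> carrier R" "a \<notin> P" using assms f by (auto simp: a_def leading_def)
  have \<alpha>: "\<alpha> \<in> multi_indices n" 
    by (rule ccontr) (use coef_outside[OF f, of \<alpha>] a in \<open>simp add: a_def\<close>)
  define h where "h = f \<oplus> (\<ominus> a) \<otimes> mon \<alpha>"
  have h: "h \<in> carrier A" using f a by (simp add: h_def)
  have "coef h \<gamma> = coef f \<gamma> \<oplus> (\<ominus> a) \<otimes> (if \<gamma> = \<alpha> then \<one> else \<zero>)" for \<gamma>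
    unfolding h_def using f a coef_add coef_smult[of "\<ominus> a" "mon \<alpha>"] coef_mon[OF \<alpha>] by simp
  then have "h \<in> lower (weight \<alpha>)"
    using h assms a f by (auto simp: lower_def leading_def a_def r_neg)
  moreover have "f = a \<otimes> mon \<alpha> \<oplus> h"
    using f a by (simp add: h_def l_minus a_lcomm r_neg)
  ultimately show ?thesis using that a \<alpha> by blast
qed

text \<open>Multiplication by \<open>x\<^sub>i\<close> shifts weights by \<open>v i\<close> on general elements as soon as it does so on monomials.
The assumption on monomials is restricted to small weights, so that this lemma and the next one
can be used inside the induction that establishes it.\<close>

lemma var_mult_lower_aux:
  assumes "i < n" "f \<in> lower m"
    and IH: "\<And>\<gamma>. \<gamma> \<in> multi_indices n \<Longrightarrow> weight \<gamma> < m \<Longrightarrow> x i \<otimes> mon \<gamma> \<in> leading (inc i \<gamma>)"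
  shows "x i \<otimes> f \<in> lower (m + v i)"
proof (rule mult_in_submonoid_right[OF _ _ lower_submonoid])
  have f: "f \<in> carrier A" using assms(2) lower_sub by auto
  fix \<gamma> assume \<gamma>: "\<gamma> \<in> multi_indices n"
  let ?c = "coef f \<gamma>"
  have c: "?c \<in> carrier R" using f by simp
  have "\<sigma> i ?c \<otimes> (x i \<otimes> mon \<gamma>) \<oplus> \<delta> i ?c \<otimes> mon \<gamma> \<in> lower (m + v i)"
  proof (cases "weight \<gamma> < m")
    case True
    then have *: "x i \<otimes> mon \<gamma> \<in> lower (m + v i)" "mon \<gamma> \<in> lower (m + v i)"
      using leading_lower[OF IH[OF \<gamma>]] leading_lower[OF mon_leading[OF \<gamma>]] assms(1) by simp_all
    show ?thesis by (intro lower_add lower_smult[OF _ *(1)] lower_smult[OF _ *(2)]) (use assms(1) c in auto)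
  next
    case False
    then have "?c \<in> P" using assms(2) by (simp add: lower_def)
    then show ?thesis
      by (intro extended_ideal_lower extended_ideal_add P_mult_in_extended_ideal)
        (use assms(1) P_sigma P_delta in auto)
  qed
  then show "x i \<otimes> (?c \<otimes> mon \<gamma>) \<in> lower (m + v i)"
    using var_smult_mon[OF assms(1) c, of "mon \<gamma>"] by simp
qed (use assms lower_sub in auto)

lemma var_mult_leading_aux:
  assumes i: "i < n" and f: "f \<in> leading \<alpha>"
    and top: "x i \<otimes> mon \<alpha> \<in> leading (inc i \<alpha>)"
    and IH: "\<And>\<gamma>. \<gamma> \<in> multi_indices n \<Longrightarrow> weight \<gamma> < weight \<alpha> \<Longrightarrow> x i \<otimes> mon \<gamma> \<in> leading (inc i \<gamma>)"
  shows "x i \<otimes> f \<in> leading (inc i \<alpha>)"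
proof -
  obtain a h where a: "a \<in> carrier R" "a \<notin> P" and \<alpha>: "\<alpha> \<in> multi_indices n"
    and h: "h \<in> lower (weight \<alpha>)" and eq: "f = a \<otimes> mon \<alpha> \<oplus> h"
    using leading_split[OF f] by blast
  have hA: "h \<in> carrier A" using h lower_sub by auto
  have "x i \<otimes> f = x i \<otimes> (a \<otimes> mon \<alpha>) \<oplus> x i \<otimes> h"
    unfolding eq using i a hA by (simp add: r_distr)
  also have "\<dots> = \<sigma> i a \<otimes> (x i \<otimes> mon \<alpha>) \<oplus> (\<delta> i a \<otimes> mon \<alpha> \<oplus> x i \<otimes> h)"
    using var_smult_mon[OF i a(1), of "mon \<alpha>"] i a hA by (simp add: a_assoc)
  also have "\<dots> \<in> leading (inc i \<alpha>)"
  proof (rule leading_add_lower)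
    show "\<sigma> i a \<otimes> (x i \<otimes> mon \<alpha>) \<in> leading (inc i \<alpha>)"
      by (rule leading_smult[OF _ _ top]) (use P_sigma i a in auto)
    have "\<delta> i a \<otimes> mon \<alpha> \<in> lower (weight \<alpha> + v i)"
      by (intro lower_smult leading_lower[OF mon_leading[OF \<alpha>]]) (use i a v_pos in auto)
    moreover have "x i \<otimes> h \<in> lower (weight \<alpha> + v i)"
      using var_mult_lower_aux[OF i h IH] by simp
    ultimately show "\<delta> i a \<otimes> mon \<alpha> \<oplus> x i \<otimes> h \<in> lower (weight (inc i \<alpha>))"
      using i by (simp add: lower_add)
  qed
  finally show ?thesis .
qed

text \<open>If \<open>x\<^sub>i\<close> does not have to pass any variable of \<open>x\<^sup>\<beta>\<close>, then \<open>x\<^sub>i x\<^sup>\<beta>\<close> is a monomial. Otherwise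
\<open>x\<^sup>\<beta> = x\<^sub>j x\<^sup>\<beta>\<^sup>'\<close> with \<open>j < i\<close>, and \<open>x\<^sub>i x\<^sub>j x\<^sup>\<beta>\<^sup>'\<close> is \<open>d x\<^sub>j (x\<^sub>i x\<^sup>\<beta>\<^sup>')\<close> up to lower terms. By induction
\<open>x\<^sub>i x\<^sup>\<beta>\<^sup>'\<close> has the leading exponent \<open>\<gamma> = \<beta>' + e\<^sub>i\<close>, and \<open>x\<^sub>j x\<^sup>\<gamma>\<close> is a monomial because \<open>j\<close> is the first
index of \<open>\<beta>\<close>. Modulo \<open>P A\<close> the remaining terms of \<open>x\<^sub>i x\<^sup>\<beta>\<^sup>'\<close> have weight below that of \<open>\<gamma>\<close>,
and the induction hypothesis applies to them because \<open>v i \<le> v j\<close> bounds the weight of \<open>\<gamma>\<close> by that of \<open>\<beta>\<close>.\<close>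

lemma var_mult_mon_leading:
  assumes "i < n" "\<beta> \<in> multi_indices n"
  shows "x i \<otimes> mon \<beta> \<in> leading (inc i \<beta>)"
  using assms
proof (induction "weight \<beta>" arbitrary: i \<beta> rule: less_induct)
  case less
  show ?case
  proof (cases "\<forall>k<i. \<beta> k = 0")
    case True
    then show ?thesis using var_mult_mon mon_leading less.prems by simp
  next
    case False
    then obtain k where k: "k < i" "\<beta> k \<noteq> 0" by blast
    then obtain j \<beta>' where j: "j < n" and \<beta>': "\<beta>' \<in> multi_indices n"
      and \<beta>: "\<beta> = inc j \<beta>'" and below: "\<forall>i<j. \<beta>' i = 0"
      using multi_index_decompose[OF less.prems(2)] by (metis (no_types))
    have ji: "j < i" using k below by (metis \<beta> inc_apply less_trans linorder_neqE_nat)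
    have i: "i < n" using less.prems by simp
    obtain d e r t where d: "d \<in> carrier R" "e \<in> carrier R" "e \<otimes> d = \<one>"
      and rt: "r \<in> carrier R" "t \<in> {..<n} \<rightarrow> carrier R"
      and rel: "x i \<otimes> x j = d \<otimes> (x j \<otimes> x i) \<oplus> affine_part r t"
      using commutation_relation_invertible[OF ji i] by blast
    note aff = affine_part_closed[OF rt]
    have IH': "x k \<otimes> mon \<beta>' \<in> leading (inc k \<beta>')" if "k < n" for k
      using less.hyps[OF _ that \<beta>'] v_pos[OF j] j by (simp add: \<beta>)
    define \<gamma> where "\<gamma> = inc i \<beta>'"
    have \<gamma>: "\<gamma> \<in> multi_indices n" using i \<beta>' by (simp add: \<gamma>_def)
    have swap: "inc j \<gamma> = inc i \<beta>" by (simp add: \<gamma>_def \<beta> inc_commute)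
    have "x j \<otimes> mon \<gamma> = mon (inc j \<gamma>)" using var_mult_mon[OF j] ji below by (simp add: \<gamma>_def inc_apply)
    then have top: "x j \<otimes> mon \<gamma> \<in> leading (inc j \<gamma>)" using mon_leading \<gamma> j by simp
    have "weight \<gamma> \<le> weight \<beta>" using v_antimono[OF ji i] i j by (simp add: \<gamma>_def \<beta>)
    then have main: "x j \<otimes> (x i \<otimes> mon \<beta>') \<in> leading (inc i \<beta>)"
      using var_mult_leading_aux[OF j IH'[OF i] top[unfolded \<gamma>_def]] less.hyps[OF _ j] swap
      by (simp add: \<gamma>_def)
    have "affine_part r t \<otimes> mon \<beta>' \<in> lower (weight (inc i \<beta>))"
    proof (rule affine_part_mult_in_submonoid[OF rt _ lower_submonoid])
      show "r \<otimes> mon \<beta>' \<in> lower (weight (inc i \<beta>))"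
        by (intro lower_smult leading_lower[OF mon_leading[OF \<beta>']])
          (use rt i j v_pos in \<open>auto simp: \<beta>\<close>)
      show "t k \<otimes> (x k \<otimes> mon \<beta>') \<in> lower (weight (inc i \<beta>))" if "k < n" for k
        by (intro lower_smult leading_lower[OF IH'])
          (use rt i j v_sum[OF j i that] that in \<open>auto simp: \<beta>\<close>)
    qed simp
    then have "d \<otimes> (x j \<otimes> (x i \<otimes> mon \<beta>')) \<oplus> affine_part r t \<otimes> mon \<beta>' \<in> leading (inc i \<beta>)"
      using leading_add_lower leading_smult[OF d(1) left_invertible_notin_P[OF d] main] by blast
    also have "d \<otimes> (x j \<otimes> (x i \<otimes> mon \<beta>')) \<oplus> affine_part r t \<otimes> mon \<beta>' = x i \<otimes> (x j \<otimes> mon \<beta>')"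
    proof -
      have "x i \<otimes> (x j \<otimes> mon \<beta>') = (x i \<otimes> x j) \<otimes> mon \<beta>'" using i j by (simp add: m_assoc)
      then show ?thesis unfolding rel using i j d aff by (simp add: l_distr m_assoc)
    qed
    also have "x j \<otimes> mon \<beta>' = mon \<beta>" using var_mult_mon[OF j below] by (simp add: \<beta>)
    finally show ?thesis .
  qed
qed

lemma var_mult_lower: "i < n \<Longrightarrow> f \<in> lower m \<Longrightarrow> x i \<otimes> f \<in> lower (m + v i)"
  by (rule var_mult_lower_aux) (auto intro: var_mult_mon_leading)

lemma var_mult_leading: "i < n \<Longrightarrow> f \<in> leading \<alpha> \<Longrightarrow> x i \<otimes> f \<in> leading (inc i \<alpha>)"
  using leading_split[of f \<alpha>] by (metis var_mult_leading_aux var_mult_mon_leading)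

lemma mon_mult_lower:
  assumes "\<alpha> \<in> multi_indices n" "f \<in> lower m"
  shows "mon \<alpha> \<otimes> f \<in> lower (weight \<alpha> + m)"
  using assms(1)
proof (induction rule: multi_index_induct)
  case zero
  have "weight (\<lambda>_. 0) = 0" by (simp add: weight_def)
  then show ?case using assms(2) subsetD[OF lower_sub assms(2)] by simp
next
  case (inc \<alpha> j)
  have f: "f \<in> carrier A" using assms(2) lower_sub by auto
  have "mon (inc j \<alpha>) \<otimes> f = x j \<otimes> (mon \<alpha> \<otimes> f)"
    using inc f by (simp add: var_mult_mon[symmetric] m_assoc)
  then show ?case using var_mult_lower[OF inc(2,4)] inc(2) by (simp add: ac_simps)
qed

lemma mon_mult_leading:
  assumes "\<alpha> \<in> multi_indices n" "f \<in> leading \<beta>"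
  shows "mon \<alpha> \<otimes> f \<in> leading (\<lambda>i. \<alpha> i + \<beta> i)"
  using assms(1)
proof (induction rule: multi_index_induct)
  case zero
  then show ?case using assms(2) leading_closed by simp
next
  case (inc \<alpha> j)
  have f: "f \<in> carrier A" using assms(2) by (rule leading_closed)
  have "mon (inc j \<alpha>) \<otimes> f = x j \<otimes> (mon \<alpha> \<otimes> f)"
    using inc f by (simp add: var_mult_mon[symmetric] m_assoc)
  moreover have "inc j (\<lambda>i. \<alpha> i + \<beta> i) = (\<lambda>i. inc j \<alpha> i + \<beta> i)" by (auto simp: inc_apply)
  ultimately show ?case using var_mult_leading[OF inc(2,4)] by simp
qed

text \<open>In \<open>f g\<close> the leading term of \<open>f\<close> times \<open>g\<close> dominates: a lower term of \<open>f\<close> has strictly smaller weight,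
and so its product with \<open>g\<close> stays below \<open>weight \<alpha> + weight \<beta>\<close>.\<close>

lemma leading_mult:
  assumes "f \<in> leading \<alpha>" "g \<in> leading \<beta>"
  shows "f \<otimes> g \<in> leading (\<lambda>i. \<alpha> i + \<beta> i)"
proof -
  let ?\<gamma> = "\<lambda>i. \<alpha> i + \<beta> i"
  have weight: "weight ?\<gamma> = weight \<alpha> + weight \<beta>"
    by (simp add: weight_def add_mult_distrib sum.distrib)
  obtain a h where a: "a \<in> carrier R" "a \<notin> P" and \<alpha>: "\<alpha> \<in> multi_indices n"
    and h: "h \<in> lower (weight \<alpha>)" and eq: "f = a \<otimes> mon \<alpha> \<oplus> h"
    using leading_split[OF assms(1)] by blast
  have hA: "h \<in> carrier A" using h lower_sub by auto
  have g: "g \<in> carrier A" using assms(2) by (rule leading_closed)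
  have "h \<otimes> g \<in> lower (weight ?\<gamma>)"
  proof (rule mult_in_submonoid_left[OF hA g lower_submonoid])
    fix \<gamma> assume \<gamma>: "\<gamma> \<in> multi_indices n"
    show "coef h \<gamma> \<otimes> (mon \<gamma> \<otimes> g) \<in> lower (weight ?\<gamma>)"
    proof (cases "weight \<gamma> < weight \<alpha>")
      case True
      have "mon \<gamma> \<otimes> g \<in> lower (weight \<gamma> + Suc (weight \<beta>))"
        by (rule mon_mult_lower[OF \<gamma> leading_lower[OF assms(2)]]) simp
      then have "mon \<gamma> \<otimes> g \<in> lower (weight ?\<gamma>)"
        by (rule lower_mono[rotated]) (use True weight in simp)
      then show ?thesis using lower_smult hA by simp
    next
      case False
      then have "coef h \<gamma> \<in> P" using h by (simp add: lower_def)
      then show ?thesis using P_mult_in_extended_ideal extended_ideal_lower g by simp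
    qed
  qed
  moreover have "a \<otimes> (mon \<alpha> \<otimes> g) \<in> leading ?\<gamma>"
    by (rule leading_smult[OF a mon_mult_leading[OF \<alpha> assms(2)]])
  ultimately have "a \<otimes> (mon \<alpha> \<otimes> g) \<oplus> h \<otimes> g \<in> leading ?\<gamma>" by (simp add: leading_add_lower)
  then show ?thesis unfolding eq using a hA g by (simp add: l_distr m_assoc)
qed

lemma leading_exists:
  assumes "f \<in> carrier A" "f \<notin> extended_ideal" "inj_on weight (supp f)"
  obtains \<alpha> where "f \<in> leading \<alpha>"
proof -
  let ?S = "{\<gamma>. coef f \<gamma> \<notin> P}"
  have sub: "?S \<subseteq> supp f" by (auto simp: supp_def)
  have fin: "finite (weight ` ?S)" using finite_subset[OF sub finite_supp[OF assms(1)]] by simp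
  have ne: "weight ` ?S \<noteq> {}" using assms(1,2) by (auto simp: extended_ideal_def)
  obtain \<alpha> where \<alpha>: "coef f \<alpha> \<notin> P" "weight \<alpha> = Max (weight ` ?S)"
    using Max_in[OF fin ne] by auto
  have "coef f \<gamma> \<in> P" if "\<gamma> \<noteq> \<alpha>" "weight \<alpha> \<le> weight \<gamma>" for \<gamma>
  proof (rule ccontr)
    assume \<gamma>: "coef f \<gamma> \<notin> P"
    then have "weight \<gamma> \<le> weight \<alpha>" using Max_ge[OF fin] \<alpha>(2) by auto
    then have "\<gamma> = \<alpha>" using that(2) \<gamma> \<alpha>(1) sub inj_onD[OF assms(3)] by auto
    then show False using that(1) by simp
  qed
  then show ?thesis using that[of \<alpha>] \<alpha>(1) assms(1) by (simp add: leading_def)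
qed

end

section \<open>Complete primeness of the extended ideal\<close>

lemma (in ring) self_in_principal_right_ideal:
  assumes "p \<in> carrier R"
  shows "p \<in> principal_right_ideal R p"
proof -
  have "p = p \<otimes> \<one>" using assms by simp
  then show ?thesis unfolding principal_right_ideal_def by blast
qed

context skew_pbw_prime begin

text \<open>Two elements outside \<open>P A\<close> have leading terms with respect to a weight that separates the monomials
in their supports, and so has their product.\<close>

lemma extended_ideal_completely_prime:
  assumes f: "f \<in> carrier A" and g: "g \<in> carrier A" and fg: "f \<otimes> g \<in> extended_ideal"
  shows "f \<in> extended_ideal \<or> g \<in> extended_ideal"
proof (rule ccontr)
  assume notin: "\<not> (f \<in> extended_ideal \<or> g \<in> extended_ideal)"
  have fin: "finite (supp f \<union> supp g)" "supp f \<union> supp g \<subseteq> multi_indices n"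
    using finite_supp supp_multi_indices f g by auto
  obtain v where v: "\<And>i j. i < j \<Longrightarrow> j < n \<Longrightarrow> v j \<le> v i"
    "\<And>i j k. i < n \<Longrightarrow> j < n \<Longrightarrow> k < n \<Longrightarrow> v k < v i + v j"
    and inj: "inj_on (\<lambda>\<alpha>. \<Sum>i<n. \<alpha> i * v i) (supp f \<union> supp g)"
    using separating_weights_exist[OF fin] by blast
  interpret weighted_skew_pbw_prime A R n x \<sigma> \<delta> P v by standard (use v in auto)
  have "inj_on weight (supp f \<union> supp g)" using inj unfolding weight_def .
  then have "inj_on weight (supp f)" "inj_on weight (supp g)" by (auto intro: inj_on_subset)
  then obtain \<alpha> \<beta> where "f \<in> leading \<alpha>" "g \<in> leading \<beta>"
    using leading_exists f g notin by metis
  from leading_mult[OF this] show False using fg by (simp add: leading_def extended_ideal_def)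
qed

lemma pow_in_extended_ideal:
  assumes "f \<in> carrier A" "f [^] (k::nat) \<in> extended_ideal"
  shows "f \<in> extended_ideal"
  using assms(2)
proof (induction k)
  case 0
  have "coef \<one> (\<lambda>_. 0) = \<one>" using coef_mon[of "\<lambda>_. 0" "\<lambda>_. 0"] by simp
  moreover have "coef \<one> (\<lambda>_. 0) \<in> P" using 0 by (simp add: extended_ideal_def)
  ultimately have False using P_proper by simp
  then show ?case ..
next
  case (Suc k)
  then show ?case using extended_ideal_completely_prime[of "f [^] k" f] assms(1) by auto
qed

lemma nilpotents_sub_extended_ideal: "nilpotents A \<subseteq> extended_ideal"
proof
  fix f assume "f \<in> nilpotents A"
  then obtain k :: nat where "f \<in> carrier A" "f [^] k = \<zero>" by (auto simp: nilpotents_def)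
  then show "f \<in> extended_ideal"
    using pow_in_extended_ideal[of f k] extended_ideal_zero by simp
qed

lemma extended_ideal_principal:
  assumes c: "c \<in> carrier R" and P: "P = principal_right_ideal R c"
  shows "extended_ideal = principal_right_ideal A c"
proof
  have "c \<in> P" unfolding P by (rule ring.self_in_principal_right_ideal[OF base_ring c])
  then show "principal_right_ideal A c \<subseteq> extended_ideal"
    using P_mult_in_extended_ideal by (auto simp: principal_right_ideal_def)
  show "extended_ideal \<subseteq> principal_right_ideal A c" (is "_ \<subseteq> ?V")
  proof
    fix f assume f: "f \<in> extended_ideal"
    have fA: "f \<in> carrier A" using f extended_ideal_sub by auto
    have "f \<otimes> \<one> \<in> ?V"
    proof (rule mult_in_submonoid_left[OF fA one_closed])
      show "?V \<subseteq> carrier A" using c by (auto simp: principal_right_ideal_def)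
      show "\<zero> \<in> ?V" using c by (auto simp: principal_right_ideal_def intro!: exI[of _ \<zero>])
      show "u \<oplus> w \<in> ?V" if u: "u \<in> ?V" and w: "w \<in> ?V" for u w
      proof -
        obtain s t where "s \<in> carrier A" "t \<in> carrier A" "u = c \<otimes> s" "w = c \<otimes> t"
          using u w by (auto simp: principal_right_ideal_def)
        then have "u \<oplus> w = c \<otimes> (s \<oplus> t)" "s \<oplus> t \<in> carrier A" using c by (simp_all add: r_distr)
        then show ?thesis by (auto simp: principal_right_ideal_def)
      qed
      fix \<gamma>
      have "coef f \<gamma> \<in> P" using f by (simp add: extended_ideal_def)
      then obtain s where s: "s \<in> carrier R" "coef f \<gamma> = c \<otimes> s"
        unfolding P principal_right_ideal_def by auto
      then have "coef f \<gamma> \<otimes> (mon \<gamma> \<otimes> \<one>) = c \<otimes> (s \<otimes> mon \<gamma>)" using c by (simp add: m_assoc)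
      moreover have "s \<otimes> mon \<gamma> \<in> carrier A" using s by simp
      ultimately show "coef f \<gamma> \<otimes> (mon \<gamma> \<otimes> \<one>) \<in> ?V" unfolding principal_right_ideal_def by blast
    qed
    then show "f \<in> ?V" using fA by simp
  qed
qed

end

section \<open>Nilpotent elements under the weak annihilator condition\<close>

text \<open>Moving the factors \<open>c\<close> to the left gives \<open>(c s)\<^sup>m \<in> c\<^sup>m R\<close>.\<close>

lemma (in ring) principal_right_ideal_nil:
  assumes c: "c \<in> nilpotents R"
    and lmult: "\<And>r. r \<in> carrier R \<Longrightarrow> r \<otimes> c \<in> principal_right_ideal R c"
  shows "principal_right_ideal R c \<subseteq> nilpotents R"
proof
  fix a assume "a \<in> principal_right_ideal R c"
  then obtain s where s: "s \<in> carrier R" "a = c \<otimes> s" by (auto simp: principal_right_ideal_def)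
  obtain k :: nat where k: "c \<in> carrier R" "c [^] k = \<zero>" using c by (auto simp: nilpotents_def)
  have "\<exists>t\<in>carrier R. a [^] m = c [^] m \<otimes> t" for m :: nat
  proof (induction m)
    case (Suc m)
    then obtain t where t: "t \<in> carrier R" "a [^] m = c [^] m \<otimes> t" by blast
    obtain t' where t': "t' \<in> carrier R" "t \<otimes> c = c \<otimes> t'"
      using lmult[OF t(1)] by (auto simp: principal_right_ideal_def)
    have "a [^] Suc m = c [^] m \<otimes> ((t \<otimes> c) \<otimes> s)" using s t k by (simp add: m_assoc)
    also have "\<dots> = c [^] Suc m \<otimes> (t' \<otimes> s)" unfolding t'(2) using s t' k by (simp add: m_assoc)
    finally show ?case using s t' by blast
  qed (auto intro!: bexI[of _ \<one>])
  from this[of k] have "a [^] k = \<zero>" using k by auto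
  then show "a \<in> nilpotents R" using s k by (auto simp: nilpotents_def)
qed

text \<open>Regroup \<open>(b a)\<^sup>k\<^sup>+\<^sup>1 = b (a b)\<^sup>k a\<close>.\<close>

lemma (in ring) nilpotents_commute:
  assumes a: "a \<in> carrier R" and b: "b \<in> carrier R" and ab: "a \<otimes> b \<in> nilpotents R"
  shows "b \<otimes> a \<in> nilpotents R"
proof -
  have pow: "(b \<otimes> a) [^] Suc k = b \<otimes> ((a \<otimes> b) [^] k \<otimes> a)" for k
  proof (induction k)
    case (Suc k)
    have "(b \<otimes> a) [^] Suc (Suc k) = (b \<otimes> ((a \<otimes> b) [^] k \<otimes> a)) \<otimes> (b \<otimes> a)"
      using Suc by simp
    also have "\<dots> = b \<otimes> ((a \<otimes> b) [^] Suc k \<otimes> a)" using a b by (simp add: m_assoc)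
    finally show ?case .
  qed (use a b in simp)
  from ab obtain k :: nat where "(a \<otimes> b) [^] k = \<zero>" by (auto simp: nilpotents_def)
  then have "(b \<otimes> a) [^] Suc k = \<zero>" using pow[of k] a b by simp
  then show ?thesis using a b by (auto simp only: nilpotents_def mem_Collect_eq m_closed)
qed

text \<open>Left multiplication acts on each summand of a finite sum of elements of nil ideals.\<close>

lemma (in ring) NI_nilpotents_lmult:
  assumes "NI_ring R" "r \<in> carrier R" "a \<in> nilpotents R"
  shows "r \<otimes> a \<in> nilpotents R"
proof -
  have NI: "upper_nilradical R = nilpotents R" using assms(1) by (simp add: NI_ring_def)
  then have "a \<in> upper_nilradical R" using assms(3) by simp
  then obtain b F where a: "a = finsum R b F" and F: "finite F" "\<forall>I\<in>F. nil_ideal I R \<and> b I \<in> I"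
    by (auto simp: upper_nilradical_def)
  have b: "b \<in> F \<rightarrow> carrier R" using F(2) by (auto simp: nil_ideal_def intro: ideal.Icarr)
  have "r \<otimes> a = finsum R (\<lambda>I. r \<otimes> b I) F" unfolding a by (rule finsum_rdistr[OF F(1) assms(2) b])
  moreover have "\<forall>I\<in>F. nil_ideal I R \<and> r \<otimes> b I \<in> I"
    using F(2) assms(2) by (auto simp: nil_ideal_def intro: ideal.I_l_closed)
  ultimately show ?thesis using F(1) NI by (auto simp: upper_nilradical_def)
qed

lemma (in ring) principal_right_ideal_is_ideal:
  assumes c: "c \<in> carrier R"
    and lmult: "\<And>r a. r \<in> carrier R \<Longrightarrow> a \<in> principal_right_ideal R c \<Longrightarrow> r \<otimes> a \<in> principal_right_ideal R c"
  shows "ideal (principal_right_ideal R c) R"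
proof (rule idealI[OF ring_axioms])
  let ?I = "principal_right_ideal R c"
  show "subgroup ?I (add_monoid R)"
  proof (rule add.subgroupI)
    show "?I \<subseteq> carrier R" using c by (auto simp: principal_right_ideal_def)
    show "?I \<noteq> {}" by (auto simp: principal_right_ideal_def)
    show "\<ominus> a \<in> ?I" if a: "a \<in> ?I" for a
    proof -
      obtain s where "s \<in> carrier R" "a = c \<otimes> s" using a by (auto simp: principal_right_ideal_def)
      then have "\<ominus> a = c \<otimes> (\<ominus> s)" "\<ominus> s \<in> carrier R" using c by (simp_all add: r_minus)
      then show ?thesis unfolding principal_right_ideal_def by blast
    qed
    show "a \<oplus> b \<in> ?I" if a: "a \<in> ?I" and b: "b \<in> ?I" for a b
    proof -
      obtain s t where "s \<in> carrier R" "t \<in> carrier R" "a = c \<otimes> s" "b = c \<otimes> t"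
        using a b by (auto simp: principal_right_ideal_def)
      then have "a \<oplus> b = c \<otimes> (s \<oplus> t)" "s \<oplus> t \<in> carrier R" using c by (simp_all add: r_distr)
      then show ?thesis unfolding principal_right_ideal_def by blast
    qed
  qed
  show "r \<otimes> a \<in> ?I" if "a \<in> ?I" "r \<in> carrier R" for a r using lmult that by simp
  show "a \<otimes> r \<in> ?I" if a: "a \<in> ?I" and r: "r \<in> carrier R" for a r
  proof -
    obtain s where "s \<in> carrier R" "a = c \<otimes> s" using a by (auto simp: principal_right_ideal_def)
    then have "a \<otimes> r = c \<otimes> (s \<otimes> r)" "s \<otimes> r \<in> carrier R" using c r by (simp_all add: m_assoc)
    then show ?thesis unfolding principal_right_ideal_def by blast
  qed
qed

text \<open>At \<open>p = \<one>\<close> the condition \<open>gen\<close> produces a generator of \<open>N(R)\<close>. For \<open>a \<notin> N(R)\<close> it bounds the weak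
annihilator of \<open>a R\<close> by \<open>N(R)\<close>. If \<open>a b\<close> is nilpotent, then so is \<open>b a\<close>, hence \<open>b a s\<close> and, by a second rotation,
\<open>a s b\<close> for every \<open>s\<close>; thus \<open>b\<close> lies in that weak annihilator.\<close>

lemma (in ring) nilpotents_principal_completely_prime:
  assumes NI: "NI_ring R" and proper: "\<one> \<notin> nilpotents R"
    and gen: "\<forall>p\<in>carrier R. \<not> principal_right_ideal R p \<subseteq> nilpotents R \<longrightarrow>
           generated_by_nilpotent R (weak_annihilator R (principal_right_ideal R p))"
  shows "\<exists>c\<in>nilpotents R. nilpotents R = principal_right_ideal R c"
    and "ideal (nilpotents R) R"
    and "\<And>a b. a \<in> carrier R \<Longrightarrow> b \<in> carrier R \<Longrightarrow> a \<otimes> b \<in> nilpotents R \<Longrightarrow>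
       a \<in> nilpotents R \<or> b \<in> nilpotents R"
proof -
  let ?N = "nilpotents R"
  have gen': "\<exists>c\<in>?N. weak_annihilator R (principal_right_ideal R p) = principal_right_ideal R c"
    if "p \<in> carrier R" "p \<notin> ?N" for p
    using gen self_in_principal_right_ideal[OF that(1)] that
    unfolding generated_by_nilpotent_def by blast
  have sub: "?N \<subseteq> carrier R" by (auto simp: nilpotents_def)
  have "weak_annihilator R (principal_right_ideal R \<one>) = ?N"
  proof
    show "weak_annihilator R (principal_right_ideal R \<one>) \<subseteq> ?N"
      using self_in_principal_right_ideal[OF one_closed] by (force simp: weak_annihilator_def)
    show "?N \<subseteq> weak_annihilator R (principal_right_ideal R \<one>)"
      using sub NI_nilpotents_lmult[OF NI] by (auto simp: weak_annihilator_def principal_right_ideal_def)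
  qed
  then obtain c where c: "c \<in> ?N" and N: "?N = principal_right_ideal R c"
    using gen'[OF one_closed proper] by auto
  have "ideal (principal_right_ideal R c) R"
    using principal_right_ideal_is_ideal[of c] c sub NI_nilpotents_lmult[OF NI]
    unfolding N[symmetric] by blast
  then show ideal: "ideal ?N R" unfolding N .
  show "\<exists>c\<in>?N. ?N = principal_right_ideal R c" using c N by blast
  have "b \<in> ?N" if a: "a \<in> carrier R" and b: "b \<in> carrier R" and ab: "a \<otimes> b \<in> ?N" and "a \<notin> ?N" for a b
  proof -
    obtain d where d: "d \<in> ?N"
      and ann: "weak_annihilator R (principal_right_ideal R a) = principal_right_ideal R d"
      using gen'[OF a \<open>a \<notin> ?N\<close>] by blast
    have "(a \<otimes> s) \<otimes> b \<in> ?N" if s: "s \<in> carrier R" for s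
    proof -
      have "(b \<otimes> a) \<otimes> s \<in> ?N"
        using ideal.I_r_closed[OF ideal nilpotents_commute[OF a b ab] s] .
      then show ?thesis using nilpotents_commute[of b "a \<otimes> s"] a b s by (simp add: m_assoc)
    qed
    then have "b \<in> weak_annihilator R (principal_right_ideal R a)"
      using b by (auto simp: weak_annihilator_def principal_right_ideal_def)
    then have "b \<in> principal_right_ideal R d" unfolding ann .
    then show "b \<in> ?N" using ideal.I_r_closed[OF ideal d] by (auto simp: principal_right_ideal_def)
  qed
  then show "a \<in> ?N \<or> b \<in> ?N" if "a \<in> carrier R" "b \<in> carrier R" "a \<otimes> b \<in> ?N" for a b
    using that by blast
qed

section \<open>Nilpotent elements and compatibility\<close>

lemma multi_funpow_single:
  assumes "i < n"
  shows "multi_funpow n \<phi> (inc i (\<lambda>_. 0)) = \<phi> i"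
proof -
  have "foldr (\<lambda>j g. (\<phi> j ^^ inc i (\<lambda>_. 0) j) \<circ> g) js id = (if i \<in> set js then \<phi> i else id)"
    if "distinct js" for js
    using that by (induction js) (auto simp: inc_apply)
  then show ?thesis using assms by (simp add: multi_funpow_def)
qed

context skew_pbw begin

lemma Sigma_compatibleD:
  assumes "Sigma_compatible R n \<sigma>" "i < n" "a \<in> carrier R" "b \<in> carrier R"
  shows "a \<otimes> \<sigma> i b = \<zero> \<longleftrightarrow> a \<otimes> b = \<zero>"
proof -
  have "inc i (\<lambda>_. 0) \<in> multi_indices n" using assms(2) by simp
  then show ?thesis
    using assms multi_funpow_single[OF assms(2), of \<sigma>] unfolding Sigma_compatible_def base_ops by metis
qed

lemma Delta_compatibleD:
  assumes "Delta_compatible R n \<delta>" "i < n" "a \<in> carrier R" "b \<in> carrier R" "a \<otimes> b = \<zero>"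
  shows "a \<otimes> \<delta> i b = \<zero>"
proof -
  have "inc i (\<lambda>_. 0) \<in> multi_indices n" using assms(2) by simp
  then show ?thesis
    using assms multi_funpow_single[OF assms(2), of \<delta>] unfolding Delta_compatible_def base_ops by metis
qed

lemma sigma_one [simp]: "i < n \<Longrightarrow> \<sigma> i \<one> = \<one>"
  and sigma_mult [simp]: "i < n \<Longrightarrow> a \<in> carrier R \<Longrightarrow> b \<in> carrier R \<Longrightarrow> \<sigma> i (a \<otimes> b) = \<sigma> i a \<otimes> \<sigma> i b"
  using maps by (auto simp: skew_pbw_maps_def ring_hom_def)

lemma delta_mult:
  "i < n \<Longrightarrow> a \<in> carrier R \<Longrightarrow> b \<in> carrier R \<Longrightarrow> \<delta> i (a \<otimes> b) = \<sigma> i a \<otimes> \<delta> i b \<oplus> \<delta> i a \<otimes> b"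
  using maps by (auto simp: skew_pbw_maps_def skew_derivation_def)

lemma base_pow_closed [simp]: "a \<in> carrier R \<Longrightarrow> a [^] (k::nat) \<in> carrier R"
  by (induction k) simp_all

lemma sigma_nilpotent_iff:
  assumes "Sigma_compatible R n \<sigma>" "i < n" "a \<in> carrier R"
  shows "\<sigma> i a \<in> nilpotents R \<longleftrightarrow> a \<in> nilpotents R"
proof -
  have "\<sigma> i (a [^] k) = \<sigma> i a [^] k" for k :: nat
    using assms by (induction k) simp_all
  moreover have "\<sigma> i b = \<zero> \<longleftrightarrow> b = \<zero>" if "b \<in> carrier R" for b
    using Sigma_compatibleD[OF assms(1,2), of \<one> b] assms(2) that by simp
  ultimately have "\<sigma> i a [^] k = \<zero> \<longleftrightarrow> a [^] k = \<zero>" for k :: nat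
    using assms(3) base_pow_closed by metis
  then show ?thesis using assms by (simp add: nilpotents_def)
qed

text \<open>The identity \<open>a \<delta>(b c) = a \<sigma>(b) \<delta>(c) + a \<delta>(b) c\<close> has a vanishing left-hand side by
\<open>\<Delta>\<close>-compatibility. The first summand vanishes as well: \<open>a b c = 0\<close> implies \<open>a b \<delta>(c) = 0\<close>, and
\<open>\<Sigma>\<close>-compatibility allows applying \<open>\<sigma>\<close> to the product \<open>b \<delta>(c)\<close> and then removing it from the
last factor.\<close>

lemma delta_inner_factor:
  assumes compat: "Sigma_compatible R n \<sigma>" "Delta_compatible R n \<delta>" and i: "i < n"
    and abc: "a \<in> carrier R" "b \<in> carrier R" "c \<in> carrier R" and zero: "a \<otimes> (b \<otimes> c) = \<zero>"
  shows "a \<otimes> (\<delta> i b \<otimes> c) = \<zero>"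
proof -
  have "a \<otimes> (b \<otimes> \<delta> i c) = \<zero>"
    using Delta_compatibleD[OF compat(2) i, of "a \<otimes> b" c] abc zero i by (simp add: m_assoc)
  then have "a \<otimes> (\<sigma> i b \<otimes> \<sigma> i (\<delta> i c)) = \<zero>"
    using Sigma_compatibleD[OF compat(1) i, of a "b \<otimes> \<delta> i c"] abc i by simp
  then have "a \<otimes> (\<sigma> i b \<otimes> \<delta> i c) = \<zero>"
    using Sigma_compatibleD[OF compat(1) i, of "a \<otimes> \<sigma> i b" "\<delta> i c"] abc i by (simp add: m_assoc)
  moreover have "a \<otimes> (\<sigma> i b \<otimes> \<delta> i c \<oplus> \<delta> i b \<otimes> c) = \<zero>"
    using Delta_compatibleD[OF compat(2) i abc(1) _ zero] abc i by (simp add: delta_mult)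
  ultimately show ?thesis using abc i by (simp add: r_distr)
qed

text \<open>In \<open>a \<cdots> a = 0\<close> the factors are replaced by \<open>\<delta>(a)\<close> one at a time, from the right.\<close>

lemma delta_nilpotent:
  assumes compat: "Sigma_compatible R n \<sigma>" "Delta_compatible R n \<delta>" and i: "i < n"
    and a: "a \<in> nilpotents R"
  shows "\<delta> i a \<in> nilpotents R"
proof -
  from a obtain k :: nat where aR: "a \<in> carrier R" and k: "a [^] k = \<zero>"
    by (auto simp: nilpotents_def)
  have d: "\<delta> i a \<in> carrier R" using i aR by simp
  have "a [^] (k - j) \<otimes> \<delta> i a [^] j = \<zero>" if "j \<le> k" for j
    using that
  proof (induction j)
    case (Suc j)
    define m where "m = k - Suc j"
    have "k - j = Suc m" using Suc.prems by (simp add: m_def)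
    then have "a [^] m \<otimes> (a \<otimes> \<delta> i a [^] j) = \<zero>" using Suc aR d by (simp add: m_assoc)
    then have "a [^] m \<otimes> (\<delta> i a \<otimes> \<delta> i a [^] j) = \<zero>"
      by (intro delta_inner_factor[OF compat i]) (use aR d in simp_all)
    then show ?case unfolding m_def using nat_pow_Suc2[of "\<delta> i a" j] d by simp
  qed (use k in simp)
  from this[of k] have "\<delta> i a [^] k = \<zero>" using d by simp
  then show ?thesis using d by (auto simp: nilpotents_def)
qed

end

section \<open>The weak annihilators of a skew PBW extension\<close>

theorem theorem3p10:
  fixes R A :: "('a, 'b) ring_scheme" and n :: nat and x :: "nat \<Rightarrow> 'a"
    and \<sigma> \<delta> :: "nat \<Rightarrow> 'a \<Rightarrow> 'a"
  assumes "skew_pbw_extension R A n x"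
    and "skew_pbw_maps R A n x \<sigma> \<delta>"
    and "Sigma_compatible R n \<sigma>"
    and "Delta_compatible R n \<delta>"
    and "NI_ring R"
    and "\<forall>p\<in>carrier R. \<not> principal_right_ideal R p \<subseteq> nilpotents R \<longrightarrow>
           generated_by_nilpotent R (weak_annihilator R (principal_right_ideal R p))"
  shows "\<forall>f\<in>carrier A. \<not> principal_right_ideal A f \<subseteq> nilpotents A \<longrightarrow>
           generated_by_nilpotent A (weak_annihilator A (principal_right_ideal A f))"
proof (intro ballI impI)
  fix f assume f: "f \<in> carrier A" and fA: "\<not> principal_right_ideal A f \<subseteq> nilpotents A"
  have "ring A" using assms(1) by (simp add: skew_pbw_extension_def is_subring_of_def)
  then interpret A: ring A .
  interpret skew_pbw A R n x \<sigma> \<delta> by standard (fact assms(1,2))+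
  interpret R: ring R by (rule base_ring)
  have "\<one>\<^bsub>A\<^esub> \<noteq> \<zero>\<^bsub>A\<^esub>"
  proof
    assume one: "\<one>\<^bsub>A\<^esub> = \<zero>\<^bsub>A\<^esub>"
    have "a \<in> nilpotents A" if "a \<in> carrier A" for a
      using that one by (auto simp: nilpotents_def intro!: exI[of _ "0::nat"])
    then show False using fA f by (auto simp: principal_right_ideal_def)
  qed
  then have proper: "\<one>\<^bsub>R\<^esub> \<notin> nilpotents R" by (simp add: nilpotents_def)
  note N_facts = R.nilpotents_principal_completely_prime[OF assms(5) proper assms(6)]
  obtain c where c: "c \<in> nilpotents R" and N: "nilpotents R = principal_right_ideal R c"
    using N_facts(1) by blast
  have cR: "c \<in> carrier R" using c by (simp add: nilpotents_def)
  have cA: "c \<in> nilpotents A" using c by (auto simp: nilpotents_def)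
  have "skew_pbw_prime A R n x \<sigma> \<delta> (nilpotents R)"
  proof (intro skew_pbw_prime.intro skew_pbw_prime_axioms.intro)
    show "skew_pbw A R n x \<sigma> \<delta>" by (rule skew_pbw_axioms)
    show "ideal (nilpotents R) R" by (rule N_facts(2))
    show "\<one>\<^bsub>A\<^esub> \<notin> nilpotents R" using proper by simp
    show "a \<in> nilpotents R \<or> b \<in> nilpotents R"
      if "a \<in> carrier R" "b \<in> carrier R" "a \<otimes>\<^bsub>A\<^esub> b \<in> nilpotents R" for a b
      using N_facts(3)[of a b] that by simp
    show "\<sigma> i a \<in> nilpotents R \<longleftrightarrow> a \<in> nilpotents R" if "i < n" "a \<in> carrier R" for i a
      using sigma_nilpotent_iff[OF assms(3) that] .
    show "\<delta> i a \<in> nilpotents R" if "i < n" "a \<in> nilpotents R" for i a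
      using delta_nilpotent[OF assms(3,4) that] .
  qed
  then interpret skew_pbw_prime A R n x \<sigma> \<delta> "nilpotents R" .
  have E: "extended_ideal = principal_right_ideal A c" by (rule extended_ideal_principal[OF cR N])
  have "c \<in> extended_ideal"
    unfolding E by (rule A.self_in_principal_right_ideal) (use cR in simp)
  then have "r \<otimes>\<^bsub>A\<^esub> c \<in> principal_right_ideal A c" if "r \<in> carrier A" for r
    using extended_ideal_lmult that unfolding E by blast
  then have "principal_right_ideal A c \<subseteq> nilpotents A"
    by (rule A.principal_right_ideal_nil[OF cA])
  then have nilA: "nilpotents A = extended_ideal"
    using nilpotents_sub_extended_ideal E by auto
  have f_notin: "f \<notin> extended_ideal"
    using fA extended_ideal_rmult unfolding nilA by (auto simp: principal_right_ideal_def)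
  have "weak_annihilator A (principal_right_ideal A f) = extended_ideal"
  proof
    show "weak_annihilator A (principal_right_ideal A f) \<subseteq> extended_ideal"
      using extended_ideal_completely_prime[OF f] f_notin A.self_in_principal_right_ideal[OF f]
      by (auto simp: weak_annihilator_def nilA)
    show "extended_ideal \<subseteq> weak_annihilator A (principal_right_ideal A f)"
      using extended_ideal_lmult extended_ideal_sub f
      by (auto simp: weak_annihilator_def nilA principal_right_ideal_def)
  qed
  then show "generated_by_nilpotent A (weak_annihilator A (principal_right_ideal A f))"
    unfolding generated_by_nilpotent_def using cA E by auto
qed

end
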